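(* Let $b\geq 7$ be a prime. There is no non-flat vertex-faithful regular polyhedron with $2b$ vertices whose automorphism group acts primitively on its vertices.
   Context: An abstract regular polyhedron is a rank-3 abstract polytope whose automorphism group acts transitively on flags. Flat means every facet is incident to every vertex; vertex-faithful means the automorphism group acts faithfully on the vertex set. A transitive permutation group acts primitively if it preserves no nontrivial partition of the set into blocks. *)

theory Defs
  imports
    "HOL-Algebra.Group_Action"
    "HOL-Library.Disjoint_Sets"
    "HOL-Computational_Algebra.Primes"
begin

section \<open>Abstract polytopes\<close>

text \<open>
  A poset is given by its reflexive order relation \<open>r\<close>; the faces are the elements of
  \<^term>\<open>Field r\<close>, and \<open>(F, G) \<in> r\<close> reads \<open>F \<le> G\<close>.  The axioms are those of McMullen and Schulte,
  so the least face (rank \<open>-1\<close>) and the greatest face (rank \<open>n\<close>) are elements of the poset.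
  No finiteness is assumed.
\<close>

definition flags :: "'a rel \<Rightarrow> 'a set set" where
  "flags r = {\<Phi> \<in> Chains r. \<forall>\<Psi> \<in> Chains r. \<Phi> \<subseteq> \<Psi> \<longrightarrow> \<Psi> = \<Phi>}"

text \<open>
  The rank of a face \<open>F\<close> is the rank of the section \<open>F/F\<^sub>-\<^sub>1 = {G. G \<le> F}\<close>, a poset of rank \<open>i\<close>
  having \<open>i + 2\<close> elements in each of its flags.  Only \<open>i \<ge> -1\<close> is used, so that the
  cardinalities below are positive and the flags in question finite.
\<close>

definition faces_of_rank :: "'a rel \<Rightarrow> int \<Rightarrow> 'a set" where
  "faces_of_rank r i =
     {F \<in> Field r. \<forall>\<Phi> \<in> flags (Restr r (under r F)). int (card \<Phi>) = i + 2}"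

definition adjacent_flags :: "'a set \<Rightarrow> 'a set \<Rightarrow> bool" where
  "adjacent_flags \<Phi> \<Psi> \<longleftrightarrow> card (\<Phi> - \<Psi>) = 1 \<and> card (\<Psi> - \<Phi>) = 1"

definition strongly_flag_connected :: "'a rel \<Rightarrow> bool" where
  "strongly_flag_connected r \<longleftrightarrow>
     (\<forall>\<Phi> \<in> flags r. \<forall>\<Psi> \<in> flags r.
        (\<Phi>, \<Psi>) \<in> {(\<Phi>', \<Psi>'). \<Phi>' \<in> flags r \<and> \<Psi>' \<in> flags r \<and>
                        \<Phi> \<inter> \<Psi> \<subseteq> \<Phi>' \<and> \<Phi> \<inter> \<Psi> \<subseteq> \<Psi>' \<and> adjacent_flags \<Phi>' \<Psi>'}\<^sup>*)"

definition abstract_polytope :: "nat \<Rightarrow> 'a rel \<Rightarrow> bool" where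
  "abstract_polytope n r \<longleftrightarrow>
     Partial_order r \<and>
     (\<exists>L \<in> Field r. \<forall>F \<in> Field r. (L, F) \<in> r) \<and>
     (\<exists>U \<in> Field r. \<forall>F \<in> Field r. (F, U) \<in> r) \<and>
     (\<forall>\<Phi> \<in> flags r. card \<Phi> = n + 2) \<and>
     strongly_flag_connected r \<and>
     (\<forall>i \<in> {0..<int n}. \<forall>F \<in> faces_of_rank r (i - 1). \<forall>G \<in> faces_of_rank r (i + 1).
        (F, G) \<in> r \<longrightarrow> card {H \<in> faces_of_rank r i. (F, H) \<in> r \<and> (H, G) \<in> r} = 2)"

definition vertices :: "'a rel \<Rightarrow> 'a set" where
  "vertices r = faces_of_rank r 0"

definition facets :: "nat \<Rightarrow> 'a rel \<Rightarrow> 'a set" where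
  "facets n r = faces_of_rank r (int n - 1)"

definition incident :: "'a rel \<Rightarrow> 'a \<Rightarrow> 'a \<Rightarrow> bool" where
  "incident r F G \<longleftrightarrow> (F, G) \<in> r \<or> (G, F) \<in> r"

definition flat :: "nat \<Rightarrow> 'a rel \<Rightarrow> bool" where
  "flat n r \<longleftrightarrow> (\<forall>F \<in> facets n r. \<forall>v \<in> vertices r. incident r F v)"


section \<open>Automorphisms\<close>

definition polytope_auts :: "'a rel \<Rightarrow> ('a \<Rightarrow> 'a) set" where
  "polytope_auts r =
     {f \<in> Bij (Field r). \<forall>F \<in> Field r. \<forall>G \<in> Field r. (f F, f G) \<in> r \<longleftrightarrow> (F, G) \<in> r}"

definition Aut_group :: "'a rel \<Rightarrow> ('a \<Rightarrow> 'a) monoid" where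
  "Aut_group r = BijGroup (Field r) \<lparr>carrier := polytope_auts r\<rparr>"

definition regular_polytope :: "nat \<Rightarrow> 'a rel \<Rightarrow> bool" where
  "regular_polytope n r \<longleftrightarrow>
     abstract_polytope n r \<and>
     (\<forall>\<Phi> \<in> flags r. \<forall>\<Psi> \<in> flags r. \<exists>f \<in> carrier (Aut_group r). f ` \<Phi> = \<Psi>)"

abbreviation regular_polyhedron :: "'a rel \<Rightarrow> bool" where
  "regular_polyhedron \<equiv> regular_polytope 3"

definition vertex_action :: "'a rel \<Rightarrow> ('a \<Rightarrow> 'a) \<Rightarrow> 'a \<Rightarrow> 'a" where
  "vertex_action r f = restrict f (vertices r)"

definition vertex_faithful :: "'a rel \<Rightarrow> bool" where
  "vertex_faithful r \<longleftrightarrow> faithful_action (Aut_group r) (vertices r) (vertex_action r)"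

definition primitive_action ::
    "('g, 'm) monoid_scheme \<Rightarrow> 'b set \<Rightarrow> ('g \<Rightarrow> 'b \<Rightarrow> 'b) \<Rightarrow> bool" where
  "primitive_action G E \<phi> \<longleftrightarrow>
     transitive_action G E \<phi> \<and>
     (\<forall>\<B>. partition_on E \<B> \<and> (\<forall>g \<in> carrier G. \<forall>B \<in> \<B>. \<phi> g ` B \<in> \<B>)
        \<longrightarrow> \<B> = {E} \<or> \<B> = (\<lambda>x. {x}) ` E)"

definition vertex_primitive :: "'a rel \<Rightarrow> bool" where
  "vertex_primitive r \<longleftrightarrow> primitive_action (Aut_group r) (vertices r) (vertex_action r)"


section \<open>Automorphisms act on the vertices\<close>

text \<open>
  The locales used in \<^const>\<open>vertex_faithful\<close> and \<^const>\<open>vertex_primitive\<close> contain the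
  assumption that the map at hand is a group action.  It always holds.
\<close>

lemma polytope_autsD:
  assumes "f \<in> polytope_auts r"
  shows "bij_betw f (Field r) (Field r)"
    and "F \<in> Field r \<Longrightarrow> f F \<in> Field r"
    and "F \<in> Field r \<Longrightarrow> G \<in> Field r \<Longrightarrow> (f F, f G) \<in> r \<longleftrightarrow> (F, G) \<in> r"
  using assms by (auto simp: polytope_auts_def Bij_def bij_betw_def)

lemma subgroup_polytope_auts: "subgroup (polytope_auts r) (BijGroup (Field r))"
proof (rule subgroup.intro)
  show "polytope_auts r \<subseteq> carrier (BijGroup (Field r))"
    by (auto simp: polytope_auts_def BijGroup_def)
next
  fix f g assume fg: "f \<in> polytope_auts r" "g \<in> polytope_auts r"
  then have B: "f \<in> Bij (Field r)" "g \<in> Bij (Field r)"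
    by (auto simp: polytope_auts_def)
  have "compose (Field r) f g \<in> polytope_auts r"
    using compose_Bij[OF B] polytope_autsD(2,3)[OF fg(1)] polytope_autsD(2,3)[OF fg(2)]
    by (auto simp: polytope_auts_def compose_eq)
  then show "f \<otimes>\<^bsub>BijGroup (Field r)\<^esub> g \<in> polytope_auts r"
    using B by (simp add: BijGroup_def)
next
  show "\<one>\<^bsub>BijGroup (Field r)\<^esub> \<in> polytope_auts r"
    by (auto simp: BijGroup_def polytope_auts_def id_Bij)
next
  fix f assume f: "f \<in> polytope_auts r"
  then have B: "f \<in> Bij (Field r)" by (auto simp: polytope_auts_def)
  let ?g = "inv_into (Field r) f"
  have im: "f ` Field r = Field r" using polytope_autsD(1)[OF f] by (simp add: bij_betw_def)
  have g: "?g F \<in> Field r" "f (?g F) = F" if "F \<in> Field r" for F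
    using that im by (metis inv_into_into, metis f_inv_into_f)
  have "(?g F, ?g G) \<in> r \<longleftrightarrow> (F, G) \<in> r" if "F \<in> Field r" "G \<in> Field r" for F G
    using polytope_autsD(3)[OF f g(1)[OF that(1)] g(1)[OF that(2)]] g(2) that by simp
  then show "inv\<^bsub>BijGroup (Field r)\<^esub> f \<in> polytope_auts r"
    using restrict_inv_into_Bij[OF B] by (simp add: inv_BijGroup[OF B] polytope_auts_def)
qed

lemma group_Aut_group: "group (Aut_group r)"
  unfolding Aut_group_def
  by (rule subgroup.subgroup_is_group[OF subgroup_polytope_auts group_BijGroup])

lemma polytope_aut_inverse:
  assumes "f \<in> polytope_auts r"
  obtains g where "g \<in> polytope_auts r" "\<And>F. F \<in> Field r \<Longrightarrow> f (g F) = F"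
    "\<And>F. F \<in> Field r \<Longrightarrow> g (f F) = F"
proof
  have B: "f \<in> Bij (Field r)" using assms by (auto simp: polytope_auts_def)
  let ?g = "\<lambda>x \<in> Field r. inv_into (Field r) f x"
  show "?g \<in> polytope_auts r"
    using subgroup.m_inv_closed[OF subgroup_polytope_auts assms] by (simp add: inv_BijGroup[OF B])
  show "f (?g F) = F" if "F \<in> Field r" for F
    using polytope_autsD(1)[OF assms] that by (simp add: bij_betw_inv_into_right)
  show "?g (f F) = F" if "F \<in> Field r" for F
    using polytope_autsD(1,2)[OF assms] that by (simp add: bij_betw_inv_into_left)
qed

lemma Chains_subset_Field': "C \<in> Chains r \<Longrightarrow> C \<subseteq> Field r"
  by (auto simp: Chains_def Field_def)

lemma Chains_section_image:
  assumes f: "f \<in> polytope_auts r" and F: "F \<in> Field r"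
    and C: "C \<in> Chains (Restr r (under r F))"
  shows "f ` C \<in> Chains (Restr r (under r (f F)))"
proof -
  have "(f a, f b) \<in> Restr r (under r (f F))" if "(a, b) \<in> Restr r (under r F)" for a b
    using that polytope_autsD(3)[OF f] F by (auto simp: under_def Field_def)
  with C show ?thesis by (auto simp: Chains_def)
qed

lemma flags_section_image:
  assumes f: "f \<in> polytope_auts r" and F: "F \<in> Field r"
    and \<Phi>: "\<Phi> \<in> flags (Restr r (under r F))"
  shows "f ` \<Phi> \<in> flags (Restr r (under r (f F)))"
proof -
  obtain g where g: "g \<in> polytope_auts r" "\<And>F. F \<in> Field r \<Longrightarrow> f (g F) = F"
    "\<And>F. F \<in> Field r \<Longrightarrow> g (f F) = F" using polytope_aut_inverse[OF f] by blast
  have C: "\<Phi> \<in> Chains (Restr r (under r F))" using \<Phi> by (simp add: flags_def)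
  have "\<Psi> = f ` \<Phi>" if \<Psi>: "\<Psi> \<in> Chains (Restr r (under r (f F)))" "f ` \<Phi> \<subseteq> \<Psi>" for \<Psi>
  proof -
    have fld: "\<Phi> \<subseteq> Field r" "\<Psi> \<subseteq> Field r"
      using Chains_subset_Field'[OF C] Chains_subset_Field'[OF \<Psi>(1)] by (auto simp: Field_def)
    have gf: "g ` f ` \<Phi> = \<Phi>" using fld(1) g(3) by (force simp: image_image)
    have fg: "f ` g ` \<Psi> = \<Psi>" using fld(2) g(2) by (force simp: image_image)
    have "g ` \<Psi> \<in> Chains (Restr r (under r F))"
      using Chains_section_image[OF g(1) polytope_autsD(2)[OF f F] \<Psi>(1)] g(3)[OF F] by simp
    moreover have "\<Phi> \<subseteq> g ` \<Psi>" using \<Psi>(2) gf by blast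
    ultimately have "g ` \<Psi> = \<Phi>" using \<Phi> by (auto simp: flags_def)
    then show ?thesis using fg by simp
  qed
  with Chains_section_image[OF f F C] show ?thesis by (auto simp: flags_def)
qed

lemma faces_of_rank_image:
  assumes f: "f \<in> polytope_auts r" and F: "F \<in> faces_of_rank r i"
  shows "f F \<in> faces_of_rank r i"
proof -
  obtain g where g: "g \<in> polytope_auts r" "\<And>F. F \<in> Field r \<Longrightarrow> f (g F) = F"
    "\<And>F. F \<in> Field r \<Longrightarrow> g (f F) = F" using polytope_aut_inverse[OF f] by blast
  have FF: "F \<in> Field r" using F by (simp add: faces_of_rank_def)
  have "int (card \<Psi>) = i + 2" if \<Psi>: "\<Psi> \<in> flags (Restr r (under r (f F)))" for \<Psi>
  proof -
    have "g ` \<Psi> \<in> flags (Restr r (under r F))"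
      using flags_section_image[OF g(1) polytope_autsD(2)[OF f FF] \<Psi>] g(3)[OF FF] by simp
    then have "int (card (g ` \<Psi>)) = i + 2" using F by (simp add: faces_of_rank_def)
    moreover have "\<Psi> \<subseteq> Field r"
      using \<Psi> Chains_subset_Field'[of \<Psi> "Restr r (under r (f F))"]
      by (auto simp: flags_def Field_def)
    then have "inj_on g \<Psi>"
      using polytope_autsD(1)[OF g(1)] by (meson bij_betw_def inj_on_subset)
    ultimately show ?thesis by (simp add: card_image)
  qed
  then show ?thesis using polytope_autsD(2)[OF f FF] by (simp add: faces_of_rank_def)
qed

theorem group_action_vertices: "group_action (Aut_group r) (vertices r) (vertex_action r)"
proof -
  have V: "vertices r \<subseteq> Field r" by (auto simp: vertices_def faces_of_rank_def)
  have carr: "carrier (Aut_group r) = polytope_auts r" by (simp add: Aut_group_def)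
  have cl: "f x \<in> vertices r" if "f \<in> polytope_auts r" "x \<in> vertices r" for f x
    using that faces_of_rank_image by (auto simp: vertices_def)
  have B: "vertex_action r f \<in> Bij (vertices r)" if f: "f \<in> polytope_auts r" for f
  proof -
    obtain g where g: "g \<in> polytope_auts r" "\<And>F. F \<in> Field r \<Longrightarrow> f (g F) = F"
      "\<And>F. F \<in> Field r \<Longrightarrow> g (f F) = F" using polytope_aut_inverse[OF f] by blast
    have "bij_betw f (vertices r) (vertices r)"
      by (rule bij_betw_byWitness[where f' = g]) (use V g cl f in auto)
    then show ?thesis by (simp add: vertex_action_def Bij_def)
  qed
  have "vertex_action r (f \<otimes>\<^bsub>Aut_group r\<^esub> h) =
      vertex_action r f \<otimes>\<^bsub>BijGroup (vertices r)\<^esub> vertex_action r h"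
    if "f \<in> polytope_auts r" "h \<in> polytope_auts r" for f h
  proof -
    have "f \<otimes>\<^bsub>Aut_group r\<^esub> h = compose (Field r) f h"
      using that by (simp add: Aut_group_def BijGroup_def polytope_auts_def)
    moreover have "vertex_action r (compose (Field r) f h) =
        compose (vertices r) (vertex_action r f) (vertex_action r h)"
      using V cl[OF that(2)] by (auto simp: vertex_action_def compose_def fun_eq_iff)
    ultimately show ?thesis using B that by (simp add: BijGroup_def)
  qed
  then have "vertex_action r \<in> hom (Aut_group r) (BijGroup (vertices r))"
    using B by (auto simp: hom_def carr BijGroup_def)
  then show ?thesis
    by (simp add: group_action_def group_hom_def group_hom_axioms_def group_Aut_group
        group_BijGroup)
qed

end

theory Submission
  imports Defs "HOL-Algebra.Sylow" "HOL-Combinatorics.Perm" "HOL-Combinatorics.Permutations"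
begin

text \<open>
  Only primitivity and the fact that vertex stabilisers are dihedral matter.  Let \<open>G\<close> act primitively on \<open>2b\<close>
  points with dihedral point stabilisers of order \<open>2q\<close>.  An element of a stabiliser that is not an involution is
  inverted or centralised by the stabiliser of each of its fixed points; these stabilisers are maximal, so it fixes
  a single point.  Hence \<open>q\<close> is \<open>m\<close> or \<open>2m\<close> with \<open>m \<ge> 3\<close> an odd divisor of \<open>2b - 1\<close>, and a Sylow
  \<open>b\<close>-subgroup \<open>B\<close> has order \<open>b\<close> and no fixed points.  An element of odd prime order \<open>r \<noteq> b\<close> normalising \<open>B\<close>
  would fix a single point and so act freely on the \<open>B\<close>-orbit avoiding that point, forcing \<open>r\<close> to divide \<open>b\<close>.
  Thus \<open>|N(B)| = bs\<close> with \<open>s\<close> a power of two, and \<open>B\<close> has \<open>4q / s \<equiv> 1 (mod b)\<close> conjugates.  These congruences leave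
  \<open>s = 1\<close>, and the single case \<open>b = 11\<close>, \<open>q = 6\<close>, \<open>s = 2\<close>.  In both there are too many elements: those of order \<open>b\<close>,
  those that are not involutions but fix a point, and, when \<open>s = 2\<close>, those in a normaliser \<open>N(B)\<close> but not in \<open>B\<close>.
\<close>

section \<open>Finite permutation groups\<close>

text \<open>Involutions are the obstacle: a reflection may fix several vertices, so the counts of
  elements with a fixed point leave involutions out. What helps is that \<open>2b - 1\<close> is
  odd: an element of order four in a stabiliser would move all \<open>2b - 1\<close> other points in
  orbits of even length, and this limits the even part \<open>e\<close> of \<open>q\<close> to 1 or
  2. Since \<open>s\<close> is prime to the odd \<open>m\<close>, it divides \<open>4e\<close>; the
  number of conjugates of \<open>B\<close> is then \<open>u m\<close> with \<open>u\<close> a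
  divisor of 8, and as \<open>m\<close> divides \<open>2b - 1\<close>, the congruence modulo
  \<open>b\<close> has few solutions. For \<open>s = 1\<close> the elements of order
  \<open>b\<close> leave only \<open>4q\<close> others, but more than \<open>4q\<close>
  non-involutions have a fixed point. For \<open>b = 11\<close> the group order is 264, while the
  identity, 120 elements of order 11, at least 88 non-involutions with a fixed point and at least 66
  normaliser elements make 275. The dihedral shape of the stabilisers comes from strong
  flag-connectedness: flags through one vertex are joined by exchanges of edges and facets
  alone.\<close>

notation "apply" (infixl \<open>\<langle>$\<rangle>\<close> 999)

text \<open>Groups are closed sets inside the type \<open>'a perm\<close>, so that all subgroups
  share the multiplication of the type and its cancellation laws simplify products.\<close>

definition perm_group :: "'a perm set \<Rightarrow> bool" where
  "perm_group K \<longleftrightarrow> finite K \<and> 1 \<in> K \<and> (\<forall>g\<in>K. inverse g \<in> K) \<and> (\<forall>g\<in>K. \<forall>h\<in>K. g * h \<in> K)"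

lemma perm_groupD:
  assumes "perm_group K"
  shows "finite K" "1 \<in> K" "g \<in> K \<Longrightarrow> inverse g \<in> K" "g \<in> K \<Longrightarrow> h \<in> K \<Longrightarrow> g * h \<in> K"
  using assms by (auto simp: perm_group_def)

lemma perm_cancel [simp]:
  fixes g h :: "'a perm"
  shows "inverse g * (g * h) = h" "g * (inverse g * h) = h"
  by (simp_all flip: mult.assoc)

lemma perm_group_card_pos: "perm_group K \<Longrightarrow> card K > 0"
  by (auto simp: perm_group_def card_gt_0_iff)

text \<open>The action \<open>f\<close> is a parameter because orbits are counted for several
  actions: on points, on a group by left multiplication, on cosets, and on subgroups by
  conjugation.\<close>

definition acts_on :: "'a perm set \<Rightarrow> ('a perm \<Rightarrow> 'x \<Rightarrow> 'x) \<Rightarrow> 'x set \<Rightarrow> bool" where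
  "acts_on K f X \<longleftrightarrow> (\<forall>x\<in>X. f 1 x = x) \<and> (\<forall>g\<in>K. \<forall>x\<in>X. f g x \<in> X) \<and>
     (\<forall>g\<in>K. \<forall>h\<in>K. \<forall>x\<in>X. f (g * h) x = f g (f h x))"

lemma acts_onD:
  assumes "acts_on K f X" "x \<in> X"
  shows "f 1 x = x" "g \<in> K \<Longrightarrow> f g x \<in> X"
    "g \<in> K \<Longrightarrow> h \<in> K \<Longrightarrow> f (g * h) x = f g (f h x)"
  using assms by (auto simp: acts_on_def)

lemma acts_on_subset:
  assumes "acts_on K f X" "H \<subseteq> K" "Y \<subseteq> X" "\<And>g x. g \<in> H \<Longrightarrow> x \<in> Y \<Longrightarrow> f g x \<in> Y"
  shows "acts_on H f Y"
  using assms unfolding acts_on_def by blast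

lemma acts_on_inverse:
  assumes "perm_group K" "acts_on K f X" "x \<in> X" "g \<in> K"
  shows "f (inverse g) (f g x) = x" "f g (f (inverse g) x) = x"
  using acts_onD(1)[OF assms(2,3)] acts_onD(3)[OF assms(2,3), of "inverse g" g]
    acts_onD(3)[OF assms(2,3), of g "inverse g"] assms(4) perm_groupD(3)[OF assms(1,4)]
  by simp_all

definition act_orbit :: "'a perm set \<Rightarrow> ('a perm \<Rightarrow> 'x \<Rightarrow> 'x) \<Rightarrow> 'x \<Rightarrow> 'x set" where
  "act_orbit K f x = (\<lambda>g. f g x) ` K"

definition act_stab :: "'a perm set \<Rightarrow> ('a perm \<Rightarrow> 'x \<Rightarrow> 'x) \<Rightarrow> 'x \<Rightarrow> 'a perm set" where
  "act_stab K f x = {g \<in> K. f g x = x}"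

lemma perm_group_stab:
  assumes "perm_group K" "acts_on K f X" "x \<in> X"
  shows "perm_group (act_stab K f x)"
proof -
  note KD = perm_groupD[OF assms(1)] and AD = acts_onD[OF assms(2,3)]
  have "f (inverse g) x = x" if "g \<in> K" "f g x = x" for g
    using acts_on_inverse(1)[OF assms that(1)] that(2) by simp
  moreover have "f (g * h) x = x" if "g \<in> K" "h \<in> K" "f g x = x" "f h x = x" for g h
    using AD(3)[OF that(1,2)] that(3,4) by simp
  ultimately show ?thesis using KD AD(1) by (simp add: perm_group_def act_stab_def)
qed

lemma card_orbit_stab:
  assumes K: "perm_group K" and A: "acts_on K f X" "x \<in> X"
  shows "card (act_orbit K f x) * card (act_stab K f x) = card K"
proof -
  note KD = perm_groupD[OF K] and AD = acts_onD[OF A] and AI = acts_on_inverse[OF K A]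
  \<comment> \<open>These fibres are the left cosets of the stabiliser, all of the same
    size.\<close>
  let ?F = "\<lambda>y. {g \<in> K. f g x = y}"
  have F: "card (?F y) = card (act_stab K f x)" if y: "y \<in> act_orbit K f x" for y
  proof -
    obtain g where g: "g \<in> K" "y = f g x" using y unfolding act_orbit_def by blast
    have "bij_betw ((*) g) (act_stab K f x) (?F y)"
    proof (rule bij_betw_byWitness[where f' = "(*) (inverse g)"])
      have "g * h \<in> ?F y" if "h \<in> act_stab K f x" for h
        using that KD(4)[OF g(1), of h] AD(3)[OF g(1), of h] g(2) by (simp add: act_stab_def)
      then show "(*) g ` act_stab K f x \<subseteq> ?F y" by blast
      have "inverse g * h \<in> act_stab K f x" if "h \<in> ?F y" for h
        using that KD(4)[OF KD(3)[OF g(1)], of h] AD(3)[OF KD(3)[OF g(1)], of h] AI(1)[OF g(1)] g(2)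
        by (simp add: act_stab_def)
      then show "(*) (inverse g) ` ?F y \<subseteq> act_stab K f x"
        by blast
    qed auto
    then show ?thesis by (simp add: bij_betw_same_card)
  qed
  have "K = (\<Union>y \<in> act_orbit K f x. ?F y)" by (auto simp: act_orbit_def)
  moreover have "card (\<Union>y \<in> act_orbit K f x. ?F y) = (\<Sum>y \<in> act_orbit K f x. card (?F y))"
    using KD(1) by (intro card_UN_disjoint) (auto simp: act_orbit_def)
  ultimately show ?thesis using F by simp
qed

lemma orbit_refl:
  assumes "perm_group K" "acts_on K f X" "x \<in> X"
  shows "x \<in> act_orbit K f x"
  using acts_onD(1)[OF assms(2,3)] perm_groupD(2)[OF assms(1)] by (force simp: act_orbit_def)

lemma orbit_eqI:
  assumes K: "perm_group K" and A: "acts_on K f X" "x \<in> X" and y: "y \<in> act_orbit K f x"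
  shows "act_orbit K f y = act_orbit K f x"
proof -
  obtain g where g: "g \<in> K" "y = f g x" using y by (auto simp: act_orbit_def)
  note KD = perm_groupD[OF K] and AD = acts_onD[OF A]
  have "f h y \<in> act_orbit K f x" if "h \<in> K" for h
    unfolding act_orbit_def g(2) AD(3)[OF that g(1), symmetric] by (rule imageI) (rule KD(4)[OF that g(1)])
  moreover have "f h x \<in> act_orbit K f y" if "h \<in> K" for h
  proof -
    have k: "h * inverse g \<in> K" using KD(3,4) that g(1) by blast
    have "f h x = f (h * inverse g) y"
      using AD(3)[OF k g(1)] g(2) by (simp add: mult.assoc)
    then show ?thesis using k by (simp add: act_orbit_def)
  qed
  ultimately show ?thesis unfolding act_orbit_def by blast
qed

lemma dvd_card_orbits:
  assumes K: "perm_group K" and A: "acts_on K f X" and X: "finite X"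
    and d: "\<And>x. x \<in> X \<Longrightarrow> d dvd card (act_orbit K f x)"
  shows "d dvd card X"
proof -
  let ?O = "act_orbit K f ` X"
  have "\<Union>?O = X"
    using orbit_refl[OF K A] acts_onD(2)[OF A] by (auto simp: act_orbit_def)
  moreover have "d dvd card (\<Union>?O)"
  proof (rule dvd_partition)
    show "finite (\<Union>?O)" using X calculation by simp
    show "\<forall>c\<in>?O. d dvd card c" using d by auto
    show "\<forall>c1\<in>?O. \<forall>c2\<in>?O. c1 \<noteq> c2 \<longrightarrow> c1 \<inter> c2 = {}"
      using orbit_eqI[OF K A] by (blast)
  qed
  ultimately show ?thesis by simp
qed

lemma dvd_card_semiregular:
  assumes "perm_group K" "acts_on K f X" "finite X"
    and "\<And>x g. x \<in> X \<Longrightarrow> g \<in> K \<Longrightarrow> f g x = x \<Longrightarrow> g = 1"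
  shows "card K dvd card X"
proof (rule dvd_card_orbits[OF assms(1-3)])
  fix x assume x: "x \<in> X"
  have "act_stab K f x = {1}"
    using assms(4)[OF x] acts_onD(1)[OF assms(2) x] perm_groupD(2)[OF assms(1)]
    by (auto simp: act_stab_def)
  then show "card K dvd card (act_orbit K f x)" using card_orbit_stab[OF assms(1,2) x] by simp
qed

text \<open>Lagrange's theorem: left multiplication by a nontrivial element of \<open>H\<close>
  fixes no element of \<open>K\<close>.\<close>

lemma card_subgroup_dvd:
  assumes "perm_group H" "perm_group K" "H \<subseteq> K"
  shows "card H dvd card K"
proof (rule dvd_card_semiregular[OF assms(1)])
  show "acts_on H (*) K" using assms perm_groupD(4)[OF assms(2)]
    by (auto simp: acts_on_def mult.assoc)
qed (use perm_groupD(1)[OF assms(2)] perm.right_cancel[of _ _ 1] in auto)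

text \<open>Orbits of a \<open>p\<close>-group have \<open>p\<close>-power length, and no orbit
  inside the moved set is a single point. Moved points rather than fixed points are counted because
  most applications know the moved set outright.\<close>

lemma dvd_card_moved:
  assumes K: "perm_group K" and A: "acts_on K f X" and X: "finite X"
    and p: "prime p" "card K = p ^ k"
  shows "p dvd card {x \<in> X. \<exists>g\<in>K. f g x \<noteq> x}"
proof -
  let ?M = "{x \<in> X. \<exists>g\<in>K. f g x \<noteq> x}"
  have "acts_on K f ?M"
  proof (rule acts_on_subset[OF A])
    fix g x assume g: "g \<in> K" and "x \<in> ?M"
    then obtain h where h: "x \<in> X" "h \<in> K" "f h x \<noteq> x" by auto
    note AD = acts_onD[OF A h(1)] and KD = perm_groupD[OF K]
    \<comment> \<open>The moved set is invariant: if \<open>h\<close> moves \<open>x\<close>, its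
      conjugate by \<open>g\<close> moves \<open>f g x\<close>.\<close>
    have "f (g * h * inverse g) (f g x) \<noteq> f g x"
    proof
      assume eq: "f (g * h * inverse g) (f g x) = f g x"
      have "f (g * h * inverse g) (f g x) = f (g * h * inverse g * g) x"
        by (rule AD(3)[symmetric]) (use g h KD in auto)
      also have "\<dots> = f g (f h x)" using AD(3)[OF g h(2)] by (simp add: mult.assoc)
      finally have "f g (f h x) = f g x" using eq by simp
      then have "f (inverse g) (f g (f h x)) = f (inverse g) (f g x)" by simp
      then show False
        using acts_on_inverse(1)[OF K A] AD(2) g h by auto
    qed
    moreover have "g * h * inverse g \<in> K" using g h KD by auto
    ultimately show "f g x \<in> ?M" using AD(2)[OF g] by blast
  qed auto
  then show ?thesis
  proof (rule dvd_card_orbits[OF K])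
    fix x assume x: "x \<in> ?M"
    have o: "card (act_orbit K f x) dvd p ^ k"
      using card_orbit_stab[OF K A] x p(2) by (metis (lifting) dvd_triv_left mem_Collect_eq)
    moreover have "card (act_orbit K f x) \<noteq> 1"
    proof
      assume "card (act_orbit K f x) = 1"
      then obtain y where "act_orbit K f x = {y}" by (auto simp: card_1_singleton_iff)
      moreover have "x \<in> act_orbit K f x" using x orbit_refl[OF K A] by simp
      ultimately have "act_orbit K f x = {x}" by auto
      then show False using x by (auto simp: act_orbit_def)
    qed
    ultimately show "p dvd card (act_orbit K f x)"
      using p(1) by (metis divides_primepow_nat dvd_power gr0I power_0)
  qed (use X in auto)
qed


section \<open>Cyclic subgroups and Cauchy's theorem\<close>

definition powers :: "'a perm \<Rightarrow> 'a perm set" where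
  "powers x = range ((^) x)"

lemma power_in_powers: "x ^ i \<in> powers x"
  by (simp add: powers_def)

lemma self_in_powers: "x \<in> powers x"
  using power_in_powers[of x 1] by simp

lemma powers_subset:
  assumes "perm_group K" "x \<in> K"
  shows "powers x \<subseteq> K"
proof -
  have "x ^ i \<in> K" for i by (induction i) (use assms perm_groupD[OF assms(1)] in auto)
  then show ?thesis by (auto simp: powers_def)
qed

lemma powers_fixes: "x \<langle>$\<rangle> v = v \<Longrightarrow> y \<in> powers x \<Longrightarrow> y \<langle>$\<rangle> v = v"
proof -
  assume "x \<langle>$\<rangle> v = v"
  then have "(x ^ i) \<langle>$\<rangle> v = v" for i by (induction i) (auto simp: apply_times)
  then show "y \<in> powers x \<Longrightarrow> y \<langle>$\<rangle> v = v" by (auto simp: powers_def)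
qed

text \<open>A repetition among the powers yields a least positive \<open>n\<close> with
  \<open>x ^ n = 1\<close>, and division by \<open>n\<close> gives the rest. Natural exponents thus
  already produce the cyclic group, and \<open>card (powers x)\<close> serves as the order of
  \<open>x\<close>.\<close>

lemma finite_powers_order:
  fixes x :: "'a perm"
  assumes "finite (powers x)"
  shows "x ^ i = 1 \<longleftrightarrow> card (powers x) dvd i"
    and "powers x = (^) x ` {..<card (powers x)}"
    and "card (powers x) > 0"
proof -
  have "\<not> inj ((^) x)" using assms finite_imageD[of "(^) x" UNIV] by (auto simp: powers_def)
  then obtain j k where jk: "j < k" "x ^ j = x ^ k" by (metis injI linorder_neqE_nat)
  then have "x ^ j * x ^ (k - j) = x ^ j * 1" using power_add[of x j "k - j"] by simp
  then have "\<exists>n>0. x ^ n = 1" using jk by (intro exI[of _ "k - j"]) (metis perm.left_cancel zero_less_diff)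
  then have ex: "\<exists>n. n > 0 \<and> x ^ n = 1" by blast
  define n where "n = (LEAST n. n > 0 \<and> x ^ n = 1)"
  have n: "n > 0" "x ^ n = 1" using LeastI_ex[OF ex] by (simp_all add: n_def)
  have least: "n \<le> k" if "0 < k" "x ^ k = 1" for k
    unfolding n_def using that by (intro Least_le) simp
  have mod: "x ^ i = x ^ (i mod n)" for i
  proof -
    have "x ^ i = (x ^ n) ^ (i div n) * x ^ (i mod n)" by (simp flip: power_mult power_add)
    then show ?thesis using n(2) by simp
  qed
  have iff: "x ^ i = 1 \<longleftrightarrow> n dvd i" for i
  proof
    assume "x ^ i = 1"
    then show "n dvd i" using least[of "i mod n"] mod[of i] mod_less_divisor[OF n(1), of i]
      by (auto simp: dvd_eq_mod_eq_0)
  next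
    assume "n dvd i" then show "x ^ i = 1" using n by (auto simp: dvd_def power_mult)
  qed
  have inj: "inj_on ((^) x) {..<n}"
  proof (rule linorder_inj_onI)
    fix i j assume *: "i < j" "j \<in> {..<n}"
    show "x ^ i \<noteq> x ^ j"
    proof
      assume "x ^ i = x ^ j"
      then have "x ^ i * x ^ (j - i) = x ^ i * 1" using * power_add[of x i "j - i"] by simp
      then have "x ^ (j - i) = 1" by (simp only: perm.left_cancel)
      then show False using least[of "j - i"] * by auto
    qed
  qed auto
  have im: "powers x = (^) x ` {..<n}"
  proof
    show "powers x \<subseteq> (^) x ` {..<n}"
    proof
      fix y assume "y \<in> powers x"
      then obtain i where "y = x ^ i" by (auto simp: powers_def)
      then have "y = x ^ (i mod n)" using mod[of i] by simp
      then show "y \<in> (^) x ` {..<n}" using n(1) by simp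
    qed
  qed (auto simp: powers_def)
  then have c: "card (powers x) = n" using inj by (simp add: card_image)
  show "x ^ i = 1 \<longleftrightarrow> card (powers x) dvd i" "card (powers x) > 0"
    "powers x = (^) x ` {..<card (powers x)}" using iff c n im by auto
qed

lemma perm_group_powers:
  assumes "finite (powers x)"
  shows "perm_group (powers x)"
proof -
  let ?n = "card (powers x)"
  have n: "x ^ ?n = 1" "?n > 0" using finite_powers_order[OF assms] by auto
  have "inverse (x ^ i) = x ^ (i * (?n - 1))" for i
  proof -
    have "x ^ i * x ^ (i * (?n - 1)) = x ^ (?n * i)" using n(2)
      by (cases ?n) (simp_all flip: power_add add: algebra_simps)
    then show ?thesis using n(1) by (simp add: power_mult perm.inverse_unique)
  qed
  then have "inverse g \<in> powers x" if "g \<in> powers x" for g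
    using that by (auto simp: powers_def)
  moreover have "1 \<in> powers x" using power_in_powers[of x 0] by simp
  ultimately show ?thesis using assms unfolding perm_group_def
    by (auto simp: powers_def simp flip: power_add)
qed

lemma perm_group_powers': "perm_group K \<Longrightarrow> x \<in> K \<Longrightarrow> perm_group (powers x)"
  using perm_group_powers powers_subset perm_groupD(1) finite_subset by metis

text \<open>Sylow's theorem with exponent 1 supplies a subgroup of order \<open>p\<close>; an
  element of it other than 1 has order dividing \<open>p\<close>, hence equal to
  \<open>p\<close>.\<close>

lemma cauchy_perm:
  assumes K: "perm_group K" and p: "prime p" "p dvd card K"
  obtains x where "x \<in> K" "card (powers x) = p"
proof -
  let ?G = "\<lparr>carrier = K, monoid.mult = (*), one = 1\<rparr>"
  have G: "group ?G"
  proof (rule groupI)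
    show "\<exists>y\<in>carrier ?G. y \<otimes>\<^bsub>?G\<^esub> x = \<one>\<^bsub>?G\<^esub>" if "x \<in> carrier ?G" for x
      using that perm_groupD(3)[OF K, of x] by (intro bexI[of _ "inverse x"]) auto
  qed (use perm_groupD[OF K] in \<open>auto simp: mult.assoc\<close>)
  obtain m where "card K = p ^ 1 * m" using p(2) by auto
  then obtain H where H: "subgroup H ?G" "card H = p"
    using sylow_thm[OF p(1) G, of 1 m] perm_groupD(1)[OF K] by (auto simp: Coset.order_def)
  have HK: "H \<subseteq> K" using subgroup.subset[OF H(1)] by simp
  have "inverse g \<in> H" if "g \<in> H" for g
  proof -
    have "inv\<^bsub>?G\<^esub> g = inverse g"
      by (rule group.inv_equality[OF G]) (use that HK perm_groupD[OF K] in auto)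
    then show ?thesis using subgroup.m_inv_closed[OF H(1) that] by simp
  qed
  then have gH: "perm_group H"
    using subgroup.one_closed[OF H(1)] subgroup.m_closed[OF H(1)] HK perm_groupD(1)[OF K]
    by (auto simp: perm_group_def intro: finite_subset)
  have "H \<noteq> {1}" using H(2) prime_gt_1_nat[OF p(1)] by auto
  then obtain x where x: "x \<in> H" "x \<noteq> 1" using perm_groupD(2)[OF gH] by blast
  have "card (powers x) dvd p"
    using card_subgroup_dvd[OF perm_group_powers'[OF gH x(1)] gH powers_subset[OF gH x(1)]] H(2) by simp
  moreover have "card (powers x) \<noteq> 1"
    using x(2) finite_powers_order(1)[of x 1] perm_groupD(1)[OF perm_group_powers'[OF gH x(1)]] by auto
  ultimately show ?thesis using that[of x] x HK p(1) by (auto simp: prime_nat_iff)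
qed

section \<open>Primitive groups with dihedral point stabilisers\<close>

text \<open>Here \<open>u m\<close> is the number of Sylow \<open>b\<close>-subgroups.  Multiplying \<open>u m = 1 + l b\<close> by \<open>t\<close> shows that \<open>b\<close> divides
  \<open>t + u\<close>, which is less than \<open>3 u\<close>.\<close>

lemma count_solutions:
  fixes b m t l u :: nat
  assumes b: "b \<ge> 7" and mt: "m * t = 2 * b - 1" and u: "u \<in> {1, 2, 4, 8}" and um: "u * m = 1 + l * b" "l \<ge> 1"
  shows "u = 8 \<or> u = 4 \<and> b = 11 \<and> m = 3"
proof -
  have "u * (m * t) = (1 + l * b) * t" by (simp only: um(1)[symmetric] mult.assoc)
  then have "(t + u) + (l * t) * b = u * (m * t) + u" by (simp add: algebra_simps)
  also have "\<dots> = (2 * u) * b" unfolding mt using b by (simp add: algebra_simps)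
  finally have eq: "(t + u) + (l * t) * b = (2 * u) * b" .
  then have dv: "b dvd t + u" by (metis dvd_add_left_iff dvd_triv_right)
  have "l * t < 2 * u"
  proof (rule ccontr)
    assume "\<not> l * t < 2 * u"
    then have "2 * u * b \<le> l * t * b" by (intro mult_right_mono) auto
    moreover have "u \<ge> 1" using u by auto
    ultimately show False using eq by linarith
  qed
  moreover have "t \<le> l * t" using um(2) by simp
  ultimately have t: "t < 2 * u" by (metis le_less_trans)
  show ?thesis
  proof (cases "u = 8")
    case False
    \<comment> \<open>For \<open>u \<le> 4\<close> one has
      \<open>t + u < 3 * u \<le> 12 < 2 * b\<close>, so the multiple of \<open>b\<close> is
      \<open>b\<close> itself.\<close>
    then have "t + u < 2 * b" using u t b by auto
    moreover obtain k where k: "t + u = b * k" using dv by blast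
    ultimately have "b * k < b * 2" by simp
    then have "k < 2" by simp
    moreover have "k \<noteq> 0" using k u by (intro notI) auto
    ultimately have "b = t + u" using k by (cases k) auto
    \<comment> \<open>With \<open>u = 1\<close> or \<open>u = 2\<close> the sum \<open>t + u\<close>
      stays below 6, against \<open>b \<ge> 7\<close>. For \<open>u = 4\<close> the equation becomes
      \<open>m * t = 2 * t + 7\<close>, so \<open>t\<close> divides 7.\<close>
    then have t4: "u = 4" "b = t + 4" "t < 8" "t \<ge> 3" using u t b False by auto
    then have "t \<in> {3, 4, 5, 6, 7}" by auto
    then show ?thesis using t4(2) mt t4(1) by (elim insertE) (auto; presburger)+
  qed simp
qed

text \<open>The last assumption says that the stabiliser of \<open>v\<close> lies in the group generated by two elements \<open>s\<close> and \<open>t\<close> whose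
  squares are trivial; neither has to differ from \<open>1\<close>.\<close>

locale dihedral_primitive =
  fixes G :: "'a perm set" and V :: "'a set" and b :: nat
  assumes G: "perm_group G"
    and maps: "\<And>g v. g \<in> G \<Longrightarrow> v \<in> V \<Longrightarrow> g \<langle>$\<rangle> v \<in> V"
    and faithful: "\<And>g. g \<in> G \<Longrightarrow> (\<And>v. v \<in> V \<Longrightarrow> g \<langle>$\<rangle> v = v) \<Longrightarrow> g = 1"
    and transitive: "\<And>v w. v \<in> V \<Longrightarrow> w \<in> V \<Longrightarrow> \<exists>g\<in>G. g \<langle>$\<rangle> v = w"
    and primitive: "\<And>\<Delta> v. \<Delta> \<subseteq> V \<Longrightarrow> v \<in> \<Delta> \<Longrightarrow>
      (\<And>g u w. g \<in> G \<Longrightarrow> u \<in> \<Delta> \<Longrightarrow> g \<langle>$\<rangle> u \<in> \<Delta> \<Longrightarrow> w \<in> \<Delta> \<Longrightarrow> g \<langle>$\<rangle> w \<in> \<Delta>) \<Longrightarrow> \<Delta> = V \<or> \<Delta> = {v}"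
    and b: "prime b" "b \<ge> 7" "card V = 2 * b"
    and dihedral: "\<And>v. v \<in> V \<Longrightarrow> \<exists>s t. s \<in> G \<and> t \<in> G \<and> s \<langle>$\<rangle> v = v \<and> t \<langle>$\<rangle> v = v \<and>
      s * s = 1 \<and> t * t = 1 \<and>
      (\<forall>A. 1 \<in> A \<and> (\<forall>g\<in>A. g * s \<in> A \<and> g * t \<in> A) \<longrightarrow> {g \<in> G. g \<langle>$\<rangle> v = v} \<subseteq> A)"
begin

abbreviation fixer :: "'a \<Rightarrow> 'a perm set" where
  "fixer \<equiv> act_stab G (\<langle>$\<rangle>)"

lemmas GD = perm_groupD[OF G]

lemma finite_V: "finite V"
  using b by (intro card_ge_0_finite) auto

lemma act: "acts_on G (\<langle>$\<rangle>) V"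
  using maps by (auto simp: acts_on_def apply_times)

lemma act': "H \<subseteq> G \<Longrightarrow> acts_on H (\<langle>$\<rangle>) V"
  using act unfolding acts_on_def by blast

lemma fixer_eq: "fixer v = {g \<in> G. g \<langle>$\<rangle> v = v}"
  by (simp add: act_stab_def)

lemma fixer_iff: "g \<in> fixer v \<longleftrightarrow> g \<in> G \<and> g \<langle>$\<rangle> v = v"
  by (simp add: act_stab_def)

lemma fixer_G: "fixer v \<subseteq> G"
  by (auto simp: act_stab_def)

lemma apply_inverse_iff: "inverse g \<langle>$\<rangle> x = y \<longleftrightarrow> x = g \<langle>$\<rangle> y" for g :: "'a perm"
proof -
  have "g \<langle>$\<rangle> (inverse g \<langle>$\<rangle> x) = x" "inverse g \<langle>$\<rangle> (g \<langle>$\<rangle> y) = y"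
    by (simp_all add: apply_sequence)
  then show ?thesis by auto
qed

lemma perm_group_fixer: "v \<in> V \<Longrightarrow> perm_group (fixer v)"
  using perm_group_stab[OF G act] .

lemma orbit_V:
  assumes "v \<in> V"
  shows "act_orbit G (\<langle>$\<rangle>) v = V"
  using maps[OF _ assms] transitive[OF assms] by (auto simp: act_orbit_def)

lemma card_G: "v \<in> V \<Longrightarrow> card G = 2 * b * card (fixer v)"
  using card_orbit_stab[OF G act] orbit_V b(3) by metis

lemma fixer_conj:
  assumes "g \<in> G" "h \<in> G"
  shows "h \<in> fixer (g \<langle>$\<rangle> v) \<longleftrightarrow> inverse g * h * g \<in> fixer v"
  using assms GD(4)[OF GD(4)[OF GD(3)[OF assms(1)] assms(2)] assms(1)]
  by (simp add: fixer_iff apply_times apply_inverse_iff)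

text \<open>Since \<open>N\<close> contains \<open>fixer v\<close>, an element sending one point of
  the \<open>N\<close>-orbit of \<open>v\<close> into that orbit lies in \<open>N\<close>. The orbit
  is therefore a block, and its two possible shapes give the two alternatives for
  \<open>N\<close>.\<close>

lemma fixer_maximal:
  assumes "v \<in> V" "perm_group N" "N \<subseteq> G" "fixer v \<subseteq> N"
  shows "N = G \<or> N = fixer v"
proof -
  let ?D = "act_orbit N (\<langle>$\<rangle>) v"
  note ND = perm_groupD[OF assms(2)]
  have N: "g \<in> N" if "g \<in> G" "n \<in> N" "n' \<in> N" "g \<langle>$\<rangle> (n \<langle>$\<rangle> v) = n' \<langle>$\<rangle> v" for g n n'
  proof -
    have "inverse n' * (g * n) \<in> fixer v"
      using that assms(3) GD(3)[of n'] GD(4)[of g n] GD(4)[of "inverse n'" "g * n"]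
      by (simp add: fixer_iff apply_times apply_inverse_iff subset_iff)
    then have "inverse n' * (g * n) \<in> N" using assms(4) by blast
    then have "n' * (inverse n' * (g * n)) * inverse n \<in> N"
      using ND(4)[OF ND(4)[OF that(3)] ND(3)[OF that(2)]] by blast
    then show ?thesis by (simp add: mult.assoc)
  qed
  have "?D = V \<or> ?D = {v}"
  proof (rule primitive)
    show "?D \<subseteq> V" using assms maps by (auto simp: act_orbit_def)
    show "v \<in> ?D" using ND(2) by (force simp: act_orbit_def)
    fix g u w assume g: "g \<in> G" "u \<in> ?D" "g \<langle>$\<rangle> u \<in> ?D" "w \<in> ?D"
    then obtain n n' m where n: "n \<in> N" "n' \<in> N" "m \<in> N" "u = n \<langle>$\<rangle> v"
      "g \<langle>$\<rangle> u = n' \<langle>$\<rangle> v" "w = m \<langle>$\<rangle> v" unfolding act_orbit_def by blast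
    then have "g * m \<in> N" using N[OF g(1) n(1,2)] ND(4) by simp
    moreover have "g \<langle>$\<rangle> w = (g * m) \<langle>$\<rangle> v" by (simp add: n(6) apply_times)
    ultimately show "g \<langle>$\<rangle> w \<in> ?D" unfolding act_orbit_def by blast
  qed
  then show ?thesis
  proof
    assume D: "?D = V"
    have "g \<in> N" if "g \<in> G" for g
    proof -
      have "g \<langle>$\<rangle> v \<in> ?D" using D maps[OF that assms(1)] by simp
      then obtain n where "n \<in> N" "g \<langle>$\<rangle> v = n \<langle>$\<rangle> v" by (auto simp: act_orbit_def)
      then show ?thesis using N[OF that ND(2) \<open>n \<in> N\<close>] by simp
    qed
    then show ?thesis using assms(3) by blast
  next
    assume "?D = {v}"
    then have "g \<langle>$\<rangle> v = v" if "g \<in> N" for g using that unfolding act_orbit_def by blast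
    then have "N \<subseteq> fixer v" using assms(3) by (simp add: fixer_iff subset_iff)
    then show ?thesis using assms(4) by blast
  qed
qed

text \<open>With a trivial stabiliser the group would have order \<open>2 * b\<close>, and a
  subgroup of order 2 would lie strictly between \<open>fixer v\<close> and
  \<open>G\<close>.\<close>

lemma fixer_nontrivial:
  assumes "v \<in> V"
  shows "fixer v \<noteq> {1}"
proof
  assume f: "fixer v = {1}"
  have c: "card G = 2 * b" using card_G[OF assms] f by simp
  obtain x where x: "x \<in> G" "card (powers x) = 2"
    using cauchy_perm[OF G, of 2] c by auto
  have "powers x = G \<or> powers x = fixer v"
    using fixer_maximal[OF assms perm_group_powers'[OF G x(1)] powers_subset[OF G x(1)]] f
      power_in_powers[of x 0] by auto
  then show False using x c f b by auto
qed

text \<open>Stabilisers have equal order, so inclusion means equality, and the points sharing a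
  stabiliser form a block. Were that block \<open>V\<close>, the stabiliser would fix every point
  and be trivial.\<close>

lemma fixer_subset:
  assumes "v \<in> V" "w \<in> V" "fixer v \<subseteq> fixer w"
  shows "v = w"
proof (rule ccontr)
  assume vw: "v \<noteq> w"
  have "card (fixer v) = card (fixer w)" using card_G[OF assms(1)] card_G[OF assms(2)] b by simp
  then have eq: "fixer v = fixer w"
    using assms(3) GD(1) fixer_G by (meson card_subset_eq finite_subset)
  let ?D = "{u \<in> V. fixer u = fixer v}"
  have "?D = V \<or> ?D = {v}"
  proof (rule primitive)
    fix g u w assume g: "g \<in> G" "u \<in> ?D" "g \<langle>$\<rangle> u \<in> ?D" "w \<in> ?D"
    have "fixer (g \<langle>$\<rangle> w) = fixer (g \<langle>$\<rangle> u)"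
    proof (rule Set.set_eqI)
      fix h show "h \<in> fixer (g \<langle>$\<rangle> w) \<longleftrightarrow> h \<in> fixer (g \<langle>$\<rangle> u)"
      proof (cases "h \<in> G")
        case True
        have "fixer w = fixer u" using g by simp
        then show ?thesis by (simp only: fixer_conj[OF g(1) True])
      qed (simp add: fixer_iff)
    qed
    then show "g \<langle>$\<rangle> w \<in> ?D" using g maps by auto
  qed (use assms in auto)
  moreover have "w \<in> ?D" using eq assms by simp
  ultimately have D: "?D = V" using vw by auto
  have "g = 1" if g: "g \<in> fixer v" for g
  proof (rule faithful)
    fix u assume "u \<in> V"
    then have "fixer u = fixer v" using D by blast
    with g have "g \<in> fixer u" by simp
    then show "g \<langle>$\<rangle> u = u" by (simp add: fixer_iff)
  qed (use g fixer_G in auto)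
  then have "fixer v \<subseteq> {1}" by blast
  then show False
    using fixer_nontrivial[OF assms(1)] perm_groupD(2)[OF perm_group_fixer[OF assms(1)]] by blast
qed

text \<open>With \<open>c = s * t\<close>, the elements \<open>c ^ i\<close> and
  \<open>c ^ i * s\<close> form a set closed under right multiplication by \<open>s\<close> and
  \<open>t\<close>, so they exhaust the stabiliser. Disjointness of the two halves is not claimed
  here; it is settled in \<open>fixer_order\<close>.\<close>

lemma fixer_structure:
  assumes "v \<in> V"
  obtains c s where "c \<in> fixer v" "s \<in> fixer v" "s * s = 1"
    "fixer v = powers c \<union> (\<lambda>g. g * s) ` powers c"
    "\<And>g. g \<in> powers c \<Longrightarrow> s * g * s = inverse g"
proof -
  obtain s t where st: "s \<in> G" "t \<in> G" "s \<langle>$\<rangle> v = v" "t \<langle>$\<rangle> v = v" "s * s = 1" "t * t = 1"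
    and gen: "\<forall>A. 1 \<in> A \<and> (\<forall>g\<in>A. g * s \<in> A \<and> g * t \<in> A) \<longrightarrow> fixer v \<subseteq> A"
    using dihedral[OF assms, folded fixer_eq] by (elim exE conjE) (rule that)
  have f: "s \<in> fixer v" "t \<in> fixer v" using st by (auto simp: fixer_iff)
  note FD = perm_groupD[OF perm_group_fixer[OF assms]]
  define c where "c = s * t"
  have c: "c \<in> fixer v" using f FD(4) by (simp add: c_def)
  have P: "perm_group (powers c)" using perm_group_powers'[OF perm_group_fixer[OF assms] c] .
  have inv: "inverse s = s" "inverse t = t" using st by (simp_all add: perm.inverse_unique)
  have ss: "s * (s * g) = g" for g using st(5) by (simp flip: mult.assoc)
  have ic: "inverse c = t * s" by (simp add: c_def inv)
  have "s * c ^ i * s = inverse (c ^ i)" for i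
  proof (induction i)
    case (Suc i)
    have "s * c ^ Suc i * s = s * c ^ i * s * (s * c * s)" by (simp only: power_Suc2 mult.assoc ss)
    also have "s * c * s = inverse c" using ss[of "t * s"] by (simp add: c_def inv mult.assoc)
    finally show ?case using Suc by simp
  qed (simp add: st)
  then have conj: "s * g * s = inverse g" if "g \<in> powers c" for g using that by (auto simp: powers_def)
  have "fixer v \<subseteq> powers c \<union> (\<lambda>g. g * s) ` powers c" (is "_ \<subseteq> ?A")
  proof (rule gen[rule_format], intro conjI ballI)
    show "1 \<in> ?A" using power_in_powers[of c 0] by simp
    fix g assume "g \<in> ?A"
    then consider "g \<in> powers c" | h where "h \<in> powers c" "g = h * s" by blast
    then have "g * s \<in> ?A \<and> g * t \<in> ?A"
    proof cases
      case 1
      have "g * t = (g * inverse c) * s" using st by (simp add: ic mult.assoc)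
      then show ?thesis using 1 perm_groupD(3,4)[OF P] self_in_powers by blast
    next
      case 2
      have "g * s = h" "g * t = h * c" using 2 st by (simp_all add: mult.assoc c_def)
      moreover have "h * c \<in> powers c" using perm_groupD(4)[OF P 2(1) self_in_powers] .
      ultimately show ?thesis using 2(1) by simp
    qed
    then show "g * s \<in> ?A" "g * t \<in> ?A" by auto
  qed
  moreover have "?A \<subseteq> fixer v"
    using powers_subset[OF perm_group_fixer[OF assms] c] FD(4) f by auto
  ultimately show ?thesis using that[OF c f(1) st(5) _ conj] by blast
qed

lemma powers_commute: "x \<in> powers c \<Longrightarrow> y \<in> powers c \<Longrightarrow> x * y = y * x"
  by (auto simp: powers_def add.commute simp flip: power_add)

text \<open>The conjugates of \<open>x\<close> under the fixer of any of its fixed points are \<open>x\<close> and its inverse.  Two fixed points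
  would thus make \<open>{x, x\<inverse>}\<close> normal, because point stabilisers are maximal.\<close>

lemma unique_fixpoint:
  assumes "v \<in> V" "w \<in> V" "x \<in> fixer v" "x \<in> fixer w" "x * x \<noteq> 1"
  shows "v = w"
proof (rule ccontr)
  assume "v \<noteq> w"
  \<comment> \<open>This is the normaliser of the set consisting of \<open>x\<close> and its
    inverse.\<close>
  let ?N = "{g \<in> G. g * x * inverse g \<in> {x, inverse x}}"
  have sub: "fixer u \<subseteq> ?N" if u: "u \<in> V" "x \<in> fixer u" for u
  proof -
    obtain c s where c: "c \<in> fixer u" "s \<in> fixer u" "s * s = 1"
      and F: "fixer u = powers c \<union> (\<lambda>g. g * s) ` powers c"
      and inv: "\<And>g. g \<in> powers c \<Longrightarrow> s * g * s = inverse g"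
      using fixer_structure[OF u(1)] by metis
    have si: "inverse s = s" using c by (simp add: perm.inverse_unique)
    \<comment> \<open>An element \<open>g * s\<close> squares to 1, because \<open>s\<close> inverts
      \<open>g\<close>.\<close>
    have "x \<in> powers c"
    proof (rule ccontr)
      assume "x \<notin> powers c"
      then obtain g where g: "g \<in> powers c" "x = g * s" using u F by auto
      have "x * x = g * (s * g * s)" by (simp add: g mult.assoc)
      then show False using inv[OF g(1)] assms(5) by simp
    qed
    have P: "perm_group (powers c)" using perm_group_powers'[OF perm_group_fixer[OF u(1)] c(1)] .
    show ?thesis
    proof
      fix g assume g: "g \<in> fixer u"
      then consider "g \<in> powers c" | h where "h \<in> powers c" "g = h * s" using F by blast
      then have "g * x * inverse g \<in> {x, inverse x}"
      proof cases
        case 1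
        then show ?thesis using powers_commute[OF 1 \<open>x \<in> powers c\<close>] by (simp add: mult.assoc)
      next
        case 2
        have "g * x * inverse g = h * (s * x * s) * inverse h" by (simp add: 2 si mult.assoc)
        also have "\<dots> = h * inverse x * inverse h" using inv[OF \<open>x \<in> powers c\<close>] by simp
        also have "\<dots> = inverse x"
          using powers_commute[OF 2(1) perm_groupD(3)[OF P \<open>x \<in> powers c\<close>]] by (simp add: mult.assoc)
        finally show ?thesis by simp
      qed
      then show "g \<in> ?N" using g fixer_G by auto
    qed
  qed
  have xG: "x \<in> G" using assms fixer_G by auto
  have invN: "inverse g * x * g \<in> {x, inverse x}" if c: "g * x * inverse g \<in> {x, inverse x}" for g
  proof -
    have "x = inverse g * (g * x * inverse g) * g" by (simp add: mult.assoc)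
    then consider "x = inverse g * x * g" | "x = inverse g * inverse x * g"
      using c by (metis insertE singletonD)
    then show ?thesis
    proof cases
      case 2
      then have "inverse x = inverse (inverse g * inverse x * g)" by simp
      then show ?thesis by (simp add: mult.assoc)
    qed simp
  qed
  have conj_inv: "g * inverse x * inverse g = inverse (g * x * inverse g)" for g :: "'a perm"
    by (simp add: mult.assoc)
  have "perm_group ?N"
    unfolding perm_group_def
  proof (intro conjI ballI)
    show "finite ?N" "1 \<in> ?N" using GD by auto
    show "inverse g \<in> ?N" if "g \<in> ?N" for g using that GD invN[of g] by auto
    fix g h assume g: "g \<in> ?N" and h: "h \<in> ?N"
    have "g * h * x * inverse (g * h) = g * (h * x * inverse h) * inverse g" by (simp add: mult.assoc)
    moreover have "g * (h * x * inverse h) * inverse g \<in> {x, inverse x}"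
    proof -
      consider "h * x * inverse h = x" | "h * x * inverse h = inverse x" using h by blast
      then show ?thesis
      proof cases
        case 1 then show ?thesis using g by simp
      next
        case 2 then show ?thesis using g by (auto simp only: conj_inv mem_Collect_eq insert_iff perm.inverse_inverse)
      qed
    qed
    ultimately show "g * h \<in> ?N" using g h GD(4)[of g h] by simp
  qed
  then have "?N = G \<or> ?N = fixer v"
    by (rule fixer_maximal[OF assms(1)]) (use sub[OF assms(1,3)] in auto)
  moreover have "?N \<noteq> fixer v"
    using sub[OF assms(2,4)] fixer_subset[OF assms(2,1)] \<open>v \<noteq> w\<close> by auto
  ultimately have N: "?N = G" by blast
  \<comment> \<open>Every conjugate of \<open>x\<close> is \<open>x\<close> or its inverse and so
    fixes \<open>v\<close>; hence \<open>x\<close> fixes every point to which \<open>v\<close> can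
    be carried.\<close>
  have "x = 1"
  proof (rule faithful[OF xG])
    fix u assume "u \<in> V"
    then obtain g where g: "g \<in> G" "g \<langle>$\<rangle> v = u" using transitive assms by blast
    then have "inverse g * x * g \<in> {x, inverse x}" using N invN by blast
    then have "inverse g * x * g \<in> fixer v"
      using assms(3) perm_groupD(3)[OF perm_group_fixer[OF assms(1)]] by auto
    then have "x \<in> fixer (g \<langle>$\<rangle> v)" using fixer_conj[OF g(1) xG] by blast
    then show "x \<langle>$\<rangle> u = u" by (simp add: fixer_iff g(2))
  qed
  then show False using assms by simp
qed

lemma card_minus_point: "v \<in> V \<Longrightarrow> card (V - {v}) = 2 * b - 1"
  using b(3) by simp

lemma odd_card_minus_point: "v \<in> V \<Longrightarrow> odd (card (V - {v}))"
  using b(2,3) by simp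

lemma moved_by_powers:
  assumes "v \<in> V" "x \<in> fixer v" "x * x \<noteq> 1"
  shows "{w \<in> V. \<exists>g\<in>powers x. g \<langle>$\<rangle> w \<noteq> w} = V - {v}"
proof -
  have "x \<langle>$\<rangle> w \<noteq> w" if "w \<in> V - {v}" for w
    using unique_fixpoint[OF assms(1) _ assms(2) _ assms(3), of w] that assms(2)
    by (auto simp: fixer_iff)
  moreover have "g \<langle>$\<rangle> v = v" if "g \<in> powers x" for g
    using that assms(2) powers_fixes by (auto simp: fixer_iff)
  ultimately show ?thesis using self_in_powers[of x] by blast
qed

text \<open>\<open>q\<close> is the order of the rotation \<open>c\<close>, with even part
  \<open>e\<close> and odd part \<open>m\<close>. Powers of \<open>c\<close> whose square is not 1
  fix only \<open>v\<close> and are constrained by their action on the other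
  \<open>2 * b - 1\<close> points: order four contradicts parity, and the subgroup of order
  \<open>m\<close> acts freely. For the last bound, at most \<open>e\<close> powers of
  \<open>c\<close>, the identity included, square to 1.\<close>

lemma fixer_order:
  assumes v: "v \<in> V"
  obtains q e m where "card (fixer v) = 2 * q" "q = e * m" "e \<in> {1, 2}" "odd m" "m \<ge> 3"
    "m dvd 2 * b - 1" "q - e \<le> card {x \<in> fixer v. x * x \<noteq> 1}"
proof -
  obtain c s where c: "c \<in> fixer v" "s \<in> fixer v" "s * s = 1"
    and F: "fixer v = powers c \<union> (\<lambda>g. g * s) ` powers c"
    and inv: "\<And>g. g \<in> powers c \<Longrightarrow> s * g * s = inverse g"
    using fixer_structure[OF v] by metis
  note Fg = perm_group_fixer[OF v]
  note P = perm_group_powers'[OF Fg c(1)]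
  note ord = finite_powers_order[OF perm_groupD(1)[OF P]]
  define q where "q = card (powers c)"
  have card_coset: "card ((\<lambda>g. g * s) ` powers c) = q"
    unfolding q_def by (rule card_image) (simp add: inj_on_def perm.right_cancel)
  have two: "card (fixer v) = 2 * q" if "s \<notin> powers c"
  proof -
    have "powers c \<inter> (\<lambda>g. g * s) ` powers c = {}"
    proof (rule ccontr)
      assume "\<not> ?thesis"
      then obtain g where g: "g \<in> powers c" "g * s \<in> powers c" by blast
      then have "inverse g * (g * s) \<in> powers c" using perm_groupD(3,4)[OF P] by blast
      then show False using that by simp
    qed
    then have "card (fixer v) = card (powers c) + card ((\<lambda>g. g * s) ` powers c)"
      unfolding F using perm_groupD(1)[OF P] by (intro card_Un_disjoint) auto
    then show ?thesis using card_coset by (simp add: q_def)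
  qed
  \<comment> \<open>Otherwise the stabiliser has order 1, 2 or 4 and moves exactly the points other
    than \<open>v\<close>, whose number is odd.\<close>
  have cc: "c * c \<noteq> 1"
  proof
    assume "c * c = 1"
    then have "c ^ 2 = 1" by (simp add: power2_eq_square)
    then have "q dvd 2" using ord(1) by (simp add: q_def)
    then have q: "q = 1 \<or> q = 2" using two_is_prime_nat by (auto simp: prime_nat_iff)
    have "card (fixer v) = q \<or> card (fixer v) = 2 * q"
    proof (cases "s \<in> powers c")
      case True
      then have "fixer v = powers c" using F perm_groupD(4)[OF P] by blast
      then show ?thesis by (simp add: q_def)
    next
      case False then show ?thesis using two by blast
    qed
    then have "card (fixer v) = 2 ^ 0 \<or> card (fixer v) = 2 ^ 1 \<or> card (fixer v) = 2 ^ 2" using q by auto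
    then obtain k where "card (fixer v) = 2 ^ k" by blast
    then have "2 dvd card {w \<in> V. \<exists>g\<in>fixer v. g \<langle>$\<rangle> w \<noteq> w}"
      by (rule dvd_card_moved[OF Fg act'[OF fixer_G] finite_V two_is_prime_nat])
    moreover have "{w \<in> V. \<exists>g\<in>fixer v. g \<langle>$\<rangle> w \<noteq> w} = V - {v}"
    proof -
      have "\<exists>g\<in>fixer v. g \<langle>$\<rangle> w \<noteq> w" if "w \<in> V - {v}" for w
      proof (rule ccontr)
        assume "\<not> ?thesis"
        then have "fixer v \<subseteq> fixer w" by (auto simp: fixer_iff)
        then show False using fixer_subset[OF v, of w] that by auto
      qed
      then show ?thesis by (auto simp: fixer_iff)
    qed
    ultimately show False using odd_card_minus_point[OF v] by simp
  qed
  \<comment> \<open>Otherwise \<open>s\<close> both centralises and inverts \<open>c\<close>, and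
    \<open>c * c = 1\<close> follows.\<close>
  have s: "s \<notin> powers c"
  proof
    assume "s \<in> powers c"
    then have "c * s = s * c" using powers_commute self_in_powers by blast
    then have "s * c * s = c" using c(3) by (metis mult.assoc mult_1_right)
    then have "inverse c = c" using inv[OF self_in_powers] by simp
    then show False using cc by (metis perm.right_inverse)
  qed
  note cF = two[OF s]
  have q0: "q > 0" using ord(3) by (simp add: q_def)
  have cq: "c ^ i = 1 \<longleftrightarrow> q dvd i" for i using ord(1) by (simp add: q_def)
  have inF: "c ^ i \<in> fixer v" for i
    using powers_subset[OF Fg c(1)] power_in_powers by blast
  have card_pw: "card (powers (c ^ i)) dvd k \<longleftrightarrow> q dvd i * k" for i k
  proof -
    have "card (powers (c ^ i)) dvd k \<longleftrightarrow> (c ^ i) ^ k = 1"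
      using finite_powers_order(1) perm_groupD(1)[OF perm_group_powers'[OF Fg inF]] by blast
    then show ?thesis using cq by (simp flip: power_mult)
  qed
  \<comment> \<open>A power of \<open>c\<close> would have order four and move every point except
    \<open>v\<close>.\<close>
  have not4: "\<not> 4 dvd q"
  proof
    assume "4 dvd q"
    then obtain j where j: "q = 4 * j" by blast
    then have j0: "j > 0" using q0 by simp
    have "card (powers (c ^ j)) dvd 4" using card_pw j by (simp add: mult.commute)
    moreover have "\<not> card (powers (c ^ j)) dvd 2" unfolding card_pw using j j0 by (auto dest: dvd_imp_le)
    ultimately have c4: "card (powers (c ^ j)) = 2 ^ 2"
      using dvd_imp_le[of "card (powers (c ^ j))" 4]
      by (cases "card (powers (c ^ j)) \<in> {0,1,2,3}") auto
    have "c ^ j * c ^ j \<noteq> 1" using cq[of "j + j"] j j0 by (auto simp: power_add dest: dvd_imp_le)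
    note moved = moved_by_powers[OF v inF this]
    have "powers (c ^ j) \<subseteq> G" using powers_subset[OF Fg inF] fixer_G by blast
    from dvd_card_moved[OF perm_group_powers'[OF Fg inF] act'[OF this] finite_V two_is_prime_nat c4]
    have "2 dvd card (V - {v})" unfolding moved .
    then show False using odd_card_minus_point[OF v] by simp
  qed
  define e where "e = (if even q then 2 else 1 :: nat)"
  obtain m where m: "q = e * m" "odd m"
  proof (cases "even q")
    case True
    then obtain m where "q = 2 * m" by blast
    moreover from this have "odd m" using not4 by auto
    ultimately show ?thesis using that True by (simp add: e_def)
  next
    case False then show ?thesis using that[of q] by (simp add: e_def)
  qed
  have e: "e \<in> {1, 2}" by (simp add: e_def)
  have m1: "m \<noteq> 1"
  proof
    assume "m = 1"
    then have "q = e" using m(1) by simp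
    then have "q dvd 2" using e by (elim insertE) simp_all
    then show False using cq[of 2] cc by (simp add: power2_eq_square)
  qed
  have "m \<noteq> 0" using m by (cases m) auto
  then have m3: "m \<ge> 3" using m1 m(2) by (cases "m = 2") auto
  \<comment> \<open>\<open>c ^ e\<close> has order \<open>m\<close>. As \<open>m\<close> is odd, no
    element other than 1 of the group it generates squares to 1, so none fixes a second
    point.\<close>
  have cm: "card (powers (c ^ e)) dvd k \<longleftrightarrow> m dvd k" for k
    using card_pw[of e k] m e by auto
  then have cardm: "card (powers (c ^ e)) = m" by (metis dvd_antisym dvd_refl)
  have "m dvd card (V - {v})"
  proof -
    have "card (powers (c ^ e)) dvd card (V - {v})"
    proof (rule dvd_card_semiregular[OF perm_group_powers'[OF Fg inF]])
      have sub: "powers (c ^ e) \<subseteq> fixer v" using powers_subset[OF Fg inF] .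
      show "acts_on (powers (c ^ e)) (\<langle>$\<rangle>) (V - {v})"
      proof (rule acts_on_subset[OF act])
        fix g w assume "g \<in> powers (c ^ e)" "w \<in> V - {v}"
        then show "g \<langle>$\<rangle> w \<in> V - {v}" using sub maps apply_inj[of g w v] by (auto simp: fixer_iff subset_iff)
      qed (use sub fixer_G in auto)
      fix w g assume w: "w \<in> V - {v}" and g: "g \<in> powers (c ^ e)" "g \<langle>$\<rangle> w = w"
      have "g * g = 1"
        using unique_fixpoint[OF v, of w g] w g sub by (auto simp: fixer_iff subset_iff)
      moreover obtain i where i: "g = (c ^ e) ^ i" using g by (auto simp: powers_def)
      ultimately have "c ^ (e * i + e * i) = 1" by (simp flip: power_mult power_add)
      then have "e * m dvd e * (2 * i)" using cq m(1) by (simp add: mult_2 distrib_left)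
      then have "m dvd 2 * i" using e dvd_times_left_cancel_iff[of e m "2 * i"] by auto
      then have "m dvd i" using m(2) by (simp add: coprime_dvd_mult_right_iff)
      then show "g = 1" using i cq[of "e * i"] m(1) by (simp flip: power_mult)
    qed (use finite_V in auto)
    then show ?thesis using cardm by simp
  qed
  then have mdvd: "m dvd 2 * b - 1" using card_minus_point[OF v] by simp
  have "q - e \<le> card {x \<in> fixer v. x * x \<noteq> 1}"
  proof -
    have "{x \<in> powers c. x * x = 1} \<subseteq> (\<lambda>i. c ^ (m * i)) ` {..<e}"
    proof
      fix x assume x: "x \<in> {x \<in> powers c. x * x = 1}"
      then obtain i where i: "i < q" "x = c ^ i" using ord(2)[folded q_def] by blast
      then have "q dvd i + i" using x cq[of "i + i"] by (simp add: power_add)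
      then have "m dvd 2 * i" using m(1) by (metis dvd_mult_right mult_2)
      then have "m dvd i" using m(2) by (simp add: coprime_dvd_mult_right_iff)
      then obtain k where k: "i = m * k" by blast
      then have "k < e" using i m by (simp add: mult.commute)
      then show "x \<in> (\<lambda>i. c ^ (m * i)) ` {..<e}" using i k by auto
    qed
    then have "card {x \<in> powers c. x * x = 1} \<le> e"
      using surj_card_le[of "{..<e}" _ "\<lambda>i. c ^ (m * i)"] by simp
    moreover have "card (powers c) = card ({x \<in> powers c. x * x = 1} \<union> {x \<in> powers c. x * x \<noteq> 1})"
      by (rule arg_cong[where f = card]) auto
    moreover have "\<dots> \<le> card {x \<in> powers c. x * x = 1} + card {x \<in> powers c. x * x \<noteq> 1}"
      by (rule card_Un_le)
    moreover have "card {x \<in> powers c. x * x \<noteq> 1} \<le> card {x \<in> fixer v. x * x \<noteq> 1}"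
      using F perm_groupD(1)[OF Fg] by (intro card_mono) auto
    ultimately show ?thesis by (simp add: q_def)
  qed
  then show ?thesis using that[OF cF m(1) e m(2) m3 mdvd] by blast
qed

end

section \<open>Sylow subgroups of order \<open>b\<close>\<close>

definition conj_set :: "'a perm \<Rightarrow> 'a perm set \<Rightarrow> 'a perm set" where
  "conj_set g A = (\<lambda>x. g * x * inverse g) ` A"

lemma mem_conj_set: "x \<in> conj_set g A \<longleftrightarrow> inverse g * x * g \<in> A"
proof
  assume "inverse g * x * g \<in> A"
  moreover have "x = g * (inverse g * x * g) * inverse g" by (simp add: mult.assoc)
  ultimately show "x \<in> conj_set g A" unfolding conj_set_def by blast
qed (auto simp: conj_set_def mult.assoc)

lemma conj_set_mult: "conj_set (g * h) A = conj_set g (conj_set h A)"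
  by (auto simp: mem_conj_set mult.assoc)

lemma conj_set_1: "conj_set 1 A = A"
  by (auto simp: mem_conj_set)

lemma card_conj_set: "card (conj_set g A) = card A"
  unfolding conj_set_def by (rule card_image) (simp add: inj_on_def perm.left_cancel perm.right_cancel)

lemma perm_group_conj_set:
  assumes "perm_group A"
  shows "perm_group (conj_set g A)"
proof -
  note AD = perm_groupD[OF assms]
  have "inverse g * (x * y) * g = (inverse g * x * g) * (inverse g * y * g)" for x y
    by (simp add: mult.assoc)
  moreover have "inverse g * inverse x * g \<in> A" if "inverse g * x * g \<in> A" for x
    using AD(3)[OF that] by (simp add: mult.assoc)
  ultimately show ?thesis
    using AD unfolding perm_group_def Ball_def mem_conj_set by (simp add: conj_set_def)
qed

lemma acts_on_conj_set:
  assumes "perm_group K"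
  shows "acts_on K conj_set {A. A \<subseteq> K}"
proof -
  have "conj_set g A \<subseteq> K" if "g \<in> K" "A \<subseteq> K" for g A
    unfolding conj_set_def
    using that perm_groupD(4)[OF assms perm_groupD(4)[OF assms that(1)] perm_groupD(3)[OF assms that(1)]]
    by auto
  then show ?thesis by (simp add: acts_on_def conj_set_1 conj_set_mult)
qed

text \<open>Such an \<open>x\<close> permutes the cosets of \<open>A\<close>, whose number is prime to \<open>p\<close>, and so fixes one of them.\<close>

lemma normal_sylow_contains:
  assumes N: "perm_group N" and A: "perm_group A" "A \<subseteq> N" and norm: "\<And>n. n \<in> N \<Longrightarrow> conj_set n A = A"
    and p: "prime p" "card A = p" "card N = p * s" "\<not> p dvd s" and x: "x \<in> N" "x ^ p = 1"
  shows "x \<in> A"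
proof -
  define f where "f g C = (*) g ` C" for g :: "'a perm" and C
  define X where "X = act_orbit N f A"
  have act: "acts_on N f UNIV" by (auto simp: acts_on_def f_def image_image mult.assoc)
  \<comment> \<open>The stabiliser of the coset \<open>A\<close> is \<open>A\<close>, so the set
    \<open>X\<close> of cosets has size \<open>card N / p = s\<close>.\<close>
  have "act_stab N f A = A"
  proof
    show "act_stab N f A \<subseteq> A"
    proof
      fix g assume "g \<in> act_stab N f A"
      then have "f g A = A" by (simp add: act_stab_def)
      moreover have "g * 1 \<in> f g A" unfolding f_def using perm_groupD(2)[OF A(1)] by blast
      ultimately show "g \<in> A" by simp
    qed
    show "A \<subseteq> act_stab N f A"
    proof
      fix g assume g: "g \<in> A"
      have "h \<in> f g A" if "h \<in> A" for h
      proof -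
        have "inverse g * h \<in> A" using perm_groupD(3,4)[OF A(1)] g that by blast
        then have "g * (inverse g * h) \<in> f g A" unfolding f_def by blast
        then show ?thesis by simp
      qed
      moreover have "f g A \<subseteq> A" using perm_groupD(4)[OF A(1) g] by (auto simp: f_def)
      ultimately show "g \<in> act_stab N f A" using g A(2) by (auto simp: act_stab_def)
    qed
  qed
  then have cX: "card X = s"
    using card_orbit_stab[OF N act, of A] p prime_gt_0_nat[OF p(1)] by (simp add: X_def mult.commute)
  note Px = perm_group_powers'[OF N x(1)]
  have "card (powers x) dvd p" using finite_powers_order(1)[OF perm_groupD(1)[OF Px]] x(2) by simp
  then obtain k where k: "card (powers x) = p ^ k"
    using divides_primepow_nat[OF p(1), of _ 1] by auto
  have actX: "acts_on (powers x) f X"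
  proof (rule acts_on_subset[OF act])
    fix g C assume g: "g \<in> powers x" "C \<in> X"
    then have "g \<in> N" using powers_subset[OF N x(1)] by blast
    obtain h where h: "h \<in> N" "C = f h A" using g(2) by (auto simp: X_def act_orbit_def)
    have "f g C = f (g * h) A" by (simp add: h f_def image_image mult.assoc)
    then show "f g C \<in> X" using perm_groupD(4)[OF N \<open>g \<in> N\<close> h(1)] by (simp add: X_def act_orbit_def)
  qed (auto simp: powers_subset[OF N x(1)])
  have "finite X" using perm_groupD(1)[OF N] by (simp add: X_def act_orbit_def)
  from dvd_card_moved[OF Px actX this p(1) k]
  have "{C \<in> X. \<exists>g\<in>powers x. f g C \<noteq> C} \<noteq> X" using cX p(4) by metis
  then obtain C where C: "C \<in> X" "\<forall>g\<in>powers x. f g C = C" by blast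
  then obtain n where n: "n \<in> N" "C = f n A" by (auto simp: X_def act_orbit_def)
  have "n * 1 \<in> C" unfolding n f_def using perm_groupD(2)[OF A(1)] by blast
  then have "x * n \<in> f x C" by (auto simp: f_def)
  then have "x * n \<in> C" using C(2) self_in_powers by blast
  then obtain a where "a \<in> A" "x * n = n * a" by (auto simp: n f_def)
  then have "inverse n * (x * n) \<in> A" by simp
  then have "x \<in> conj_set n A" by (simp add: mem_conj_set mult.assoc)
  then show ?thesis using norm[OF n(1)] by simp
qed

text \<open>The data of \<open>fixer_order\<close>, with one choice of \<open>q\<close>,
  \<open>e\<close> and \<open>m\<close> valid at all points, and an element of order
  \<open>b\<close>.\<close>

locale dihedral_primitive_sylow = dihedral_primitive +
  fixes x0 :: "'a perm" and q e m :: nat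
  assumes card_fixer: "\<And>v. v \<in> V \<Longrightarrow> card (fixer v) = 2 * q"
    and q: "q = e * m" "e \<in> {1, 2}" "odd m" "m \<ge> 3" "m dvd 2 * b - 1"
    and non_involutions: "\<And>v. v \<in> V \<Longrightarrow> q - e \<le> card {x \<in> fixer v. x * x \<noteq> 1}"
    and x0: "x0 \<in> G" "card (powers x0) = b"
begin

lemma V_nonempty: "\<exists>v. v \<in> V"
  using b by (cases "V = {}") auto

lemma card_G_eq: "card G = 4 * b * q"
  using V_nonempty card_G card_fixer by fastforce

text \<open>If \<open>b\<close> divided \<open>m\<close>, it would divide both \<open>2 * b\<close>
  and \<open>2 * b - 1\<close>. So \<open>b\<close> divides the group order \<open>4 * b * q\<close>
  exactly once, and subgroups of order \<open>b\<close> are Sylow subgroups.\<close>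

lemma b_ndvd_q: "\<not> b dvd 4 * q"
proof
  assume "b dvd 4 * q"
  moreover have "\<not> b dvd 4" using b(2) by (auto dest: dvd_imp_le)
  moreover have "\<not> b dvd e" using b(2) q(2) by (auto dest: dvd_imp_le)
  ultimately have "b dvd m" using b(1) q(1) by (simp add: prime_dvd_mult_iff)
  then have "b dvd 2 * b - 1" using q(5) dvd_trans by blast
  then have "b dvd 2 * b - (2 * b - 1)" by (simp add: dvd_diff_nat)
  then show False using b(2) by simp
qed

text \<open>Taking the conjugates of a single subgroup of order \<open>b\<close> makes conjugation
  transitive on them from the outset.\<close>

definition sylows :: "'a perm set set" where
  "sylows = act_orbit G conj_set (powers x0)"

abbreviation normalizer :: "'a perm set \<Rightarrow> 'a perm set" where
  "normalizer \<equiv> act_stab G conj_set"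

lemma perm_group_x0: "perm_group (powers x0)"
  using perm_group_powers'[OF G x0(1)] .

lemma powers_x0_subset: "powers x0 \<subseteq> G"
  using powers_subset[OF G x0(1)] .

lemma finite_sylows: "finite sylows"
  using GD(1) by (simp add: sylows_def act_orbit_def)

lemma sylowsD:
  assumes "A \<in> sylows"
  shows "perm_group A" "A \<subseteq> G" "card A = b" "act_orbit G conj_set A = sylows"
proof -
  obtain g where g: "g \<in> G" "A = conj_set g (powers x0)" using assms by (auto simp: sylows_def act_orbit_def)
  show "perm_group A" "card A = b"
    unfolding g(2) using perm_group_conj_set[OF perm_group_x0] by (auto simp: card_conj_set x0)
  show "A \<subseteq> G" using acts_onD(2)[OF acts_on_conj_set[OF G] _ g(1)] powers_x0_subset g(2) by simp
  show "act_orbit G conj_set A = sylows"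
    using orbit_eqI[OF G acts_on_conj_set[OF G]] powers_x0_subset assms by (simp add: sylows_def)
qed

lemma powers_x0_sylow: "powers x0 \<in> sylows"
  using orbit_refl[OF G acts_on_conj_set[OF G]] powers_x0_subset by (simp add: sylows_def)

lemma sylow_generator:
  assumes "A \<in> sylows" "x \<in> A" "x \<noteq> 1"
  shows "powers x = A"
proof -
  note AD = sylowsD[OF assms(1)]
  note P = perm_group_powers'[OF AD(1) assms(2)]
  have "card (powers x) dvd b" using card_subgroup_dvd[OF P AD(1) powers_subset[OF AD(1) assms(2)]] AD(3) by simp
  moreover have "card (powers x) \<noteq> 1"
    using finite_powers_order(1)[OF perm_groupD(1)[OF P], of 1] assms(3) by auto
  ultimately have "card (powers x) = card A" using b(1) AD(3) by (auto simp: prime_nat_iff)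
  then show ?thesis using card_subset_eq[OF perm_groupD(1)[OF AD(1)] powers_subset[OF AD(1) assms(2)]] by simp
qed

lemma sylow_power:
  assumes "A \<in> sylows" "x \<in> A"
  shows "x ^ b = 1"
proof -
  note AD = sylowsD[OF assms(1)]
  note P = perm_group_powers'[OF AD(1) assms(2)]
  have "card (powers x) dvd b" using card_subgroup_dvd[OF P AD(1) powers_subset[OF AD(1) assms(2)]] AD(3) by simp
  then show ?thesis using finite_powers_order(1)[OF perm_groupD(1)[OF P]] by simp
qed

text \<open>A nontrivial \<open>x\<close> generates \<open>A\<close>, which would then lie in a
  stabiliser, whose order \<open>2 * q\<close> is prime to \<open>b\<close>.\<close>

lemma sylow_fixpoint_free:
  assumes "A \<in> sylows" "x \<in> A" "v \<in> V" "x \<langle>$\<rangle> v = v"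
  shows "x = 1"
proof (rule ccontr)
  assume "x \<noteq> 1"
  have "x \<in> fixer v" using assms sylowsD(2) by (auto simp: fixer_iff)
  then have "A \<subseteq> fixer v"
    using powers_subset[OF perm_group_fixer[OF assms(3)]] sylow_generator[OF assms(1,2) \<open>x \<noteq> 1\<close>] by blast
  then have "b dvd 2 * q"
    using card_subgroup_dvd[OF sylowsD(1)[OF assms(1)] perm_group_fixer[OF assms(3)]]
      sylowsD(3)[OF assms(1)] card_fixer[OF assms(3)] by simp
  then have "b dvd 2 * (2 * q)" by (rule dvd_mult)
  then show False using b_ndvd_q by simp
qed

lemma card_normalizer:
  assumes "A \<in> sylows"
  shows "card sylows * card (normalizer A) = 4 * b * q"
  using card_orbit_stab[OF G acts_on_conj_set[OF G], of A] sylowsD(2,4)[OF assms] card_G_eq by simp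

lemma perm_group_normalizer: "A \<in> sylows \<Longrightarrow> perm_group (normalizer A)"
  using perm_group_stab[OF G acts_on_conj_set[OF G]] sylowsD(2) by auto

lemma sylow_subset_normalizer:
  assumes "A \<in> sylows"
  shows "A \<subseteq> normalizer A"
proof
  fix x assume x: "x \<in> A"
  note AD = sylowsD[OF assms] and D = perm_groupD[OF sylowsD(1)[OF assms]]
  have "y \<in> conj_set x A \<longleftrightarrow> y \<in> A" for y
  proof -
    have "x * (inverse x * y * x) * inverse x = y" by (simp add: mult.assoc)
    then show ?thesis unfolding mem_conj_set using D(3,4) x by metis
  qed
  then show "x \<in> normalizer A" using x AD(2) by (auto simp: act_stab_def)
qed

text \<open>This is \<open>s\<close> in \<open>|N(B)| = bs\<close>. The division is exact and the
  value is the same for every conjugate, by \<open>card_normalizer_eq\<close>.\<close>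

definition normalizer_index :: nat where
  "normalizer_index = card (normalizer (powers x0)) div b"

lemma card_normalizer_eq:
  assumes "A \<in> sylows"
  shows "card (normalizer A) = b * normalizer_index"
proof -
  have "card sylows * card (normalizer A) = card sylows * card (normalizer (powers x0))"
    using card_normalizer[OF assms] card_normalizer[OF powers_x0_sylow] by simp
  moreover have "card sylows \<noteq> 0" using finite_sylows assms by auto
  ultimately have "card (normalizer A) = card (normalizer (powers x0))" by simp
  moreover have "b dvd card (normalizer (powers x0))"
    using card_subgroup_dvd[OF perm_group_x0 perm_group_normalizer[OF powers_x0_sylow]
      sylow_subset_normalizer[OF powers_x0_sylow]] x0 by simp
  ultimately show ?thesis by (simp add: normalizer_index_def)
qed

lemma card_sylows_index: "card sylows * normalizer_index = 4 * q"
proof -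
  have "b * (card sylows * normalizer_index) = b * (4 * q)"
    using card_normalizer[OF powers_x0_sylow] card_normalizer_eq[OF powers_x0_sylow] by (simp add: ac_simps)
  then show ?thesis using b(2) by simp
qed

lemma normalizer_order_b:
  assumes "A \<in> sylows" "x \<in> normalizer A" "x ^ b = 1"
  shows "x \<in> A"
proof (rule normal_sylow_contains[OF perm_group_normalizer[OF assms(1)] sylowsD(1)[OF assms(1)]
      sylow_subset_normalizer[OF assms(1)] _ b(1) sylowsD(3)[OF assms(1)] card_normalizer_eq[OF assms(1)] _ assms(2,3)])
  show "conj_set n A = A" if "n \<in> normalizer A" for n using that by (simp add: act_stab_def)
  show "\<not> b dvd normalizer_index" using b_ndvd_q card_sylows_index by (metis dvd_mult)
qed

lemma sylow_eqI:
  assumes "A \<in> sylows" "A' \<in> sylows" "x \<in> A" "x \<in> A'" "x \<noteq> 1"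
  shows "A = A'"
  using sylow_generator[OF assms(1,3,5)] sylow_generator[OF assms(2,4,5)] by simp

text \<open>An element of \<open>A\<close> has \<open>b\<close>-th power 1; if it normalises
  \<open>A'\<close>, it lies in \<open>A'\<close> by \<open>normalizer_order_b\<close>, and distinct
  conjugates meet trivially. Hence \<open>A\<close> acts freely by conjugation on the other
  conjugates.\<close>

lemma sylow_semiregular:
  assumes "A \<in> sylows" "A' \<in> sylows" "x \<in> A" "x \<in> normalizer A'" "A \<noteq> A'"
  shows "x = 1"
  using sylow_eqI[OF assms(1,2,3)] normalizer_order_b[OF assms(2,4) sylow_power[OF assms(1,3)]] assms(5) by blast

lemma acts_on_sylows_minus:
  assumes "A \<in> sylows" "K \<subseteq> normalizer A"
  shows "acts_on K conj_set (sylows - {A})"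
proof (rule acts_on_subset[OF acts_on_conj_set[OF G]])
  show "K \<subseteq> G" using assms(2) by (auto simp: act_stab_def)
  show "sylows - {A} \<subseteq> {A. A \<subseteq> G}" using sylowsD(2) by auto
  fix g C assume g: "g \<in> K" and C: "C \<in> sylows - {A}"
  have gG: "g \<in> G" "conj_set g A = A" using g assms(2) by (auto simp: act_stab_def)
  have "conj_set g C \<in> sylows" using sylowsD(4)[of C] C gG(1) by (auto simp: act_orbit_def)
  moreover have "conj_set g C \<noteq> A"
  proof
    assume "conj_set g C = A"
    then have "conj_set (inverse g) (conj_set g C) = conj_set (inverse g) (conj_set g A)" using gG by simp
    then show False using C by (simp add: conj_set_1 flip: conj_set_mult)
  qed
  ultimately show "conj_set g C \<in> sylows - {A}" by simp
qed

lemma card_sylows_cong: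
  obtains l where "card sylows = 1 + l * b"
proof -
  let ?B = "powers x0"
  have "card ?B dvd card (sylows - {?B})"
  proof (rule dvd_card_semiregular[OF perm_group_x0])
    show "acts_on ?B conj_set (sylows - {?B})"
      using acts_on_sylows_minus[OF powers_x0_sylow sylow_subset_normalizer[OF powers_x0_sylow]] .
    show "g = 1" if "A \<in> sylows - {?B}" "g \<in> ?B" "conj_set g A = A" for A g
      using sylow_semiregular[OF powers_x0_sylow _ that(2), of A] that powers_x0_subset by (auto simp: act_stab_def)
  qed (use finite_sylows in auto)
  then obtain l where "card (sylows - {?B}) = b * l" using x0(2) by (auto simp: dvd_def)
  then have "card sylows = 1 + l * b"
    using card_Suc_Diff1[OF finite_sylows powers_x0_sylow] by (simp add: mult.commute)
  then show ?thesis using that by blast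
qed

lemma card_sylow_orbit:
  assumes "A \<in> sylows" "v \<in> V"
  shows "card (act_orbit A (\<langle>$\<rangle>) v) = b"
proof -
  note AD = sylowsD[OF assms(1)]
  have "act_stab A (\<langle>$\<rangle>) v = {1}"
    using sylow_fixpoint_free[OF assms(1) _ assms(2)] perm_groupD(2)[OF AD(1)] by (auto simp: act_stab_def)
  then show ?thesis using card_orbit_stab[OF AD(1) act'[OF AD(2)] assms(2)] AD(3) by simp
qed

text \<open>The orbits of a normal subgroup are blocks, but those of \<open>powers x0\<close> have
  size \<open>b\<close>, which is neither 1 nor \<open>2 * b\<close>.\<close>

lemma card_sylows_neq_1: "card sylows \<noteq> 1"
proof
  assume "card sylows = 1"
  let ?B = "powers x0"
  have "sylows = {?B}" using \<open>card sylows = 1\<close> powers_x0_sylow by (auto simp: card_1_singleton_iff)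
  then have normal: "conj_set g ?B = ?B" if "g \<in> G" for g
    using that by (auto simp: sylows_def act_orbit_def)
  obtain v where v: "v \<in> V" using V_nonempty by blast
  let ?D = "act_orbit ?B (\<langle>$\<rangle>) v"
  note BD = perm_groupD[OF perm_group_x0]
  have "?D = V \<or> ?D = {v}"
  proof (rule primitive)
    show "?D \<subseteq> V" using powers_x0_subset maps v by (auto simp: act_orbit_def)
    show "v \<in> ?D" using orbit_refl[OF perm_group_x0 act'[OF powers_x0_subset] v] .
    fix g u w assume g: "g \<in> G" "u \<in> ?D" "g \<langle>$\<rangle> u \<in> ?D" "w \<in> ?D"
    then obtain x y z where xyz: "x \<in> ?B" "y \<in> ?B" "z \<in> ?B" "u = x \<langle>$\<rangle> v" "g \<langle>$\<rangle> u = y \<langle>$\<rangle> v" "w = z \<langle>$\<rangle> v"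
      unfolding act_orbit_def by blast
    \<comment> \<open>This element carries \<open>u\<close> to \<open>w\<close>; its conjugate by
      \<open>g\<close> stays in the normal subgroup and carries the image of \<open>u\<close> to the
      image of \<open>w\<close>.\<close>
    have "z * inverse x \<in> ?B" using BD xyz by blast
    then have "g * (z * inverse x) * inverse g \<in> conj_set g ?B" by (simp add: conj_set_def)
    then have h: "g * (z * inverse x) * inverse g \<in> ?B" using normal[OF g(1)] by simp
    have "g \<langle>$\<rangle> w = (g * (z * inverse x) * inverse g) \<langle>$\<rangle> (g \<langle>$\<rangle> u)"
      unfolding xyz(4,6) by (simp add: apply_sequence mult.assoc)
    also have "\<dots> = (g * (z * inverse x) * inverse g * y) \<langle>$\<rangle> v"
      unfolding xyz(5) by (simp add: apply_times)
    finally show "g \<langle>$\<rangle> w \<in> ?D" using BD(4)[OF h xyz(2)] by (simp add: act_orbit_def)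
  qed
  then have "card ?D = 2 * b \<or> card ?D = 1" using b(3) by auto
  then show False using card_sylow_orbit[OF powers_x0_sylow v] b(2) by auto
qed

lemma prime_dvd_normalizer_index:
  assumes r: "prime r" "r dvd normalizer_index"
  shows "r = 2"
proof (rule ccontr)
  assume "r \<noteq> 2"
  let ?B = "powers x0" and ?N = "normalizer (powers x0)"
  note NG = perm_group_normalizer[OF powers_x0_sylow]
  have "r dvd 4 * q" using r(2) card_sylows_index by (metis dvd_mult)
  have "r \<noteq> b" using b_ndvd_q \<open>r dvd 4 * q\<close> by auto
  have nd2: "\<not> r dvd 2" using primes_dvd_imp_eq[OF r(1) two_is_prime_nat] \<open>r \<noteq> 2\<close> by blast
  moreover have "4 = 2 * (2::nat)" by simp
  ultimately have "r dvd q" using r(1) \<open>r dvd 4 * q\<close> by (metis prime_dvd_multD)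
  then have "r dvd m" using q(1,2) r(1) nd2 by (auto simp: prime_dvd_mult_iff)
  then have rd: "r dvd 2 * b - 1" using q(5) dvd_trans by blast
  have "r dvd card ?N" using r(2) card_normalizer_eq[OF powers_x0_sylow] by simp
  then obtain x where x: "x \<in> ?N" "card (powers x) = r" using cauchy_perm[OF NG r(1)] by blast
  have xG: "x \<in> G" using x by (simp add: act_stab_def)
  note P = perm_group_powers'[OF G xG]
  have c1: "card (powers x) = r ^ 1" using x(2) by simp
  have subG: "powers x \<subseteq> G" and subN: "powers x \<subseteq> ?N"
    using powers_subset[OF G xG] powers_subset[OF NG x(1)] .
  have "x * x \<noteq> 1"
    using finite_powers_order(1)[OF perm_groupD(1)[OF P], of 2] x(2) nd2 by (simp add: power2_eq_square)
  \<comment> \<open>\<open>r\<close> divides \<open>2 * b - 1\<close> and so does not divide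
    \<open>2 * b\<close>; an element of order \<open>r\<close> cannot move every point.\<close>
  have "\<exists>v\<in>V. x \<langle>$\<rangle> v = v"
  proof (rule ccontr)
    assume "\<not> ?thesis"
    then have "{v \<in> V. \<exists>g\<in>powers x. g \<langle>$\<rangle> v \<noteq> v} = V" using self_in_powers[of x] by blast
    then have "r dvd 2 * b" using dvd_card_moved[OF P act'[OF subG] finite_V r(1) c1] b(3) by simp
    then have "r dvd 2 * b - (2 * b - 1)" using rd by (simp add: dvd_diff_nat)
    then show False using b(2) r(1) by simp
  qed
  then obtain v where v: "v \<in> V" "x \<langle>$\<rangle> v = v" by blast
  have xv: "x \<in> fixer v" using v xG by (simp add: fixer_iff)
  let ?D = "act_orbit ?B (\<langle>$\<rangle>) v"
  have D: "g \<langle>$\<rangle> u \<in> ?D" if g: "g \<in> powers x" and u: "u \<in> ?D" for g u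
  proof -
    obtain y where y: "y \<in> ?B" "u = y \<langle>$\<rangle> v" using u by (auto simp: act_orbit_def)
    have "conj_set g ?B = ?B" using g subN by (auto simp: act_stab_def)
    then have "g * y * inverse g \<in> ?B" using y(1) unfolding conj_set_def by blast
    moreover have "inverse g \<langle>$\<rangle> v = v" using powers_fixes[OF v(2) g] by (simp add: apply_inverse_iff)
    then have "(g * y * inverse g) \<langle>$\<rangle> v = g \<langle>$\<rangle> u" by (simp add: y(2) apply_times)
    ultimately show ?thesis unfolding act_orbit_def by (metis imageI)
  qed
  \<comment> \<open>\<open>x\<close> normalises \<open>?B\<close> and fixes \<open>v\<close>, so it
    preserves the orbit \<open>?D\<close> of \<open>v\<close> and the remaining \<open>b\<close>
    points, all of which it moves.\<close>
  have actW: "acts_on (powers x) (\<langle>$\<rangle>) (V - ?D)"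
  proof (rule acts_on_subset[OF act subG])
    fix g w assume g: "g \<in> powers x" "w \<in> V - ?D"
    have "g \<langle>$\<rangle> w \<notin> ?D"
    proof
      assume "g \<langle>$\<rangle> w \<in> ?D"
      then have "inverse g \<langle>$\<rangle> (g \<langle>$\<rangle> w) \<in> ?D" using D perm_groupD(3)[OF P g(1)] by blast
      then show False using g(2) by (simp add: apply_sequence)
    qed
    then show "g \<langle>$\<rangle> w \<in> V - ?D" using g subG maps by auto
  qed auto
  have "v \<in> ?D" using orbit_refl[OF perm_group_x0 act'[OF powers_x0_subset] v(1)] .
  have "\<exists>g\<in>powers x. g \<langle>$\<rangle> w \<noteq> w" if w: "w \<in> V - ?D" for w
  proof -
    have "w \<in> V - {v}" using w \<open>v \<in> ?D\<close> by auto
    then show ?thesis unfolding moved_by_powers[OF v(1) xv \<open>x * x \<noteq> 1\<close>, symmetric] by simp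
  qed
  then have "{w \<in> V - ?D. \<exists>g\<in>powers x. g \<langle>$\<rangle> w \<noteq> w} = V - ?D"
    by (intro subset_antisym subsetI) simp_all
  then have "r dvd card (V - ?D)" using dvd_card_moved[OF P actW _ r(1) c1] finite_V by simp
  moreover have "?D \<subseteq> V" using powers_x0_subset maps v by (auto simp: act_orbit_def)
  then have "card (V - ?D) = b"
    using card_sylow_orbit[OF powers_x0_sylow v(1)] b(3) finite_V by (simp add: card_Diff_subset finite_subset)
  ultimately have "r dvd b" by simp
  then show False using \<open>r \<noteq> b\<close> primes_dvd_imp_eq[OF r(1) b(1)] by blast
qed

end

section \<open>Numerical parameters and the element count\<close>

context dihedral_primitive_sylow
begin

text \<open>Only the prime 2 can divide \<open>normalizer_index\<close>, and \<open>m\<close> is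
  odd, so \<open>normalizer_index\<close> divides \<open>4 * e\<close>. The quotient
  \<open>u\<close> divides 8 and \<open>card sylows = u * m\<close>, which puts the congruence into
  the form of \<open>count_solutions\<close>.\<close>

lemma parameters:
  obtains "normalizer_index = 1" "card sylows = 4 * q"
  | "normalizer_index = 2" "card sylows = 12" "b = 11" "q = 6" "e = 2"
proof -
  let ?s = normalizer_index and ?n = "card sylows"
  have ns: "?n * ?s = 4 * e * m" using card_sylows_index unfolding q(1) by (simp only: mult.assoc)
  have "coprime ?s m"
  proof (rule ccontr)
    assume "\<not> coprime ?s m"
    then obtain p where p: "prime p" "p dvd gcd ?s m"
      using prime_factor_nat[of "gcd ?s m"] coprime_iff_gcd_eq_1 by blast
    then have "p = 2" using prime_dvd_normalizer_index by simp
    then show False using p(2) q(3) by simp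
  qed
  moreover have "?s dvd 4 * e * m" unfolding ns[symmetric] by simp
  ultimately have "?s dvd 4 * e" by (simp add: coprime_dvd_mult_left_iff)
  then obtain u where u: "4 * e = u * ?s" by (metis dvd_div_mult_self)
  have "4 * e dvd 8" "4 * e \<noteq> 0" using q(2) by auto
  then have s0: "?s \<noteq> 0" "u \<noteq> 0" using u by auto
  have "u dvd 2 ^ 3" using \<open>4 * e dvd 8\<close> u dvd_trans[of u "4 * e" 8] by simp
  then obtain k where k: "u = 2 ^ k" "k \<le> 3" using divides_primepow_nat[OF two_is_prime_nat] by blast
  then have "k \<in> {0, 1, 2, 3}" by auto
  then have u_set: "u \<in> {1, 2, 4, 8}" using k(1) by auto
  have "?n * ?s = (u * m) * ?s" using ns u by (simp add: ac_simps)
  then have n: "?n = u * m" using s0 by simp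
  obtain l where l: "?n = 1 + l * b" using card_sylows_cong by blast
  moreover have "l \<noteq> 0" using card_sylows_neq_1 l by (intro notI) simp
  ultimately have ul: "u * m = 1 + l * b" "l \<ge> 1" using n by auto
  obtain t where t: "2 * b - 1 = m * t" using q(5) by blast
  have "u = 8 \<or> u = 4 \<and> b = 11 \<and> m = 3"
    using count_solutions[OF b(2) t[symmetric] u_set ul] .
  then show ?thesis
  proof
    \<comment> \<open>Here \<open>4 * e = 8 * ?s\<close> with \<open>e \<le> 2\<close>, which forces
      \<open>e = 2\<close> and \<open>?s = 1\<close>.\<close>
    assume u8: "u = 8"
    then have "e = 2" "?s = 1" using u s0 q(2) by auto
    then show ?thesis using that(1) n u8 q(1) by simp
  next
    \<comment> \<open>Now \<open>?s = e\<close>. For \<open>e = 1\<close> there are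
      \<open>12 = 4 * q\<close> conjugates, an instance of the first alternative;
      \<open>e = 2\<close> is the second.\<close>
    assume u4: "u = 4 \<and> b = 11 \<and> m = 3"
    then have "?s = e" using u by simp
    then show ?thesis using that u4 n q(1,2) by auto
  qed
qed

definition sylow_elements :: "'a perm set" where
  "sylow_elements = (\<Union>A\<in>sylows. A - {1})"

text \<open>Without the involutions, the contributions of distinct points \<open>v\<close> are
  disjoint by \<open>unique_fixpoint\<close>, so their sizes add up.\<close>

definition rotations :: "'a perm set" where
  "rotations = (\<Union>v\<in>V. {x \<in> fixer v. x * x \<noteq> 1})"

lemma card_sylow_elements: "card sylow_elements = card sylows * (b - 1)"
proof -
  have "card sylow_elements = (\<Sum>A\<in>sylows. card (A - {1}))"
    unfolding sylow_elements_def
  proof (rule card_UN_disjoint[OF finite_sylows])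
    show "\<forall>A\<in>sylows. finite (A - {1})" using sylowsD(1) perm_groupD(1) by blast
    show "\<forall>A\<in>sylows. \<forall>A'\<in>sylows. A \<noteq> A' \<longrightarrow> (A - {1}) \<inter> (A' - {1}) = {}"
      using sylow_eqI by blast
  qed
  also have "\<dots> = (\<Sum>A\<in>sylows. b - 1)"
    by (intro sum.cong refl) (simp add: card_Diff_singleton sylowsD(3) perm_groupD(2)[OF sylowsD(1)])
  finally show ?thesis by simp
qed

lemma card_rotations: "2 * b * (q - e) \<le> card rotations"
proof -
  have "(\<Sum>v\<in>V. q - e) \<le> (\<Sum>v\<in>V. card {x \<in> fixer v. x * x \<noteq> 1})"
    by (rule sum_mono) (rule non_involutions)
  also have "\<dots> = card rotations"
    unfolding rotations_def
  proof (rule card_UN_disjoint[symmetric, OF finite_V])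
    show "\<forall>v\<in>V. finite {x \<in> fixer v. x * x \<noteq> 1}" using GD(1) by (simp add: act_stab_def)
    show "\<forall>v\<in>V. \<forall>w\<in>V. v \<noteq> w \<longrightarrow> {x \<in> fixer v. x * x \<noteq> 1} \<inter> {x \<in> fixer w. x * x \<noteq> 1} = {}"
      using unique_fixpoint by blast
  qed
  finally show ?thesis using b(3) by simp
qed

lemma sylow_elements_rotations: "sylow_elements \<inter> rotations = {}"
  using sylow_fixpoint_free by (fastforce simp: sylow_elements_def rotations_def fixer_iff)

text \<open>Sylow elements other than 1 fix no point, so they are never in \<open>rotations\<close>;
  the summand 1 is the identity. \<open>Y\<close> is empty in one application and collects
  normaliser elements in the other.\<close>

lemma element_count:
  assumes "Y \<subseteq> G" "1 \<notin> Y" "Y \<inter> sylow_elements = {}" "Y \<inter> rotations = {}"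
  shows "card Y + card sylows * (b - 1) + 2 * b * (q - e) + 1 \<le> 4 * b * q"
proof -
  have sub: "sylow_elements \<subseteq> G - {1}" "rotations \<subseteq> G - {1}"
    using sylowsD(2) by (auto simp: sylow_elements_def rotations_def fixer_iff)
  have fin: "finite S" if "S \<subseteq> G - {1}" for S using that GD(1) by (meson finite_Diff finite_subset)
  have finY: "finite Y" using assms(1) GD(1) finite_subset by blast
  have "card Y + card sylow_elements + card rotations = card (Y \<union> (sylow_elements \<union> rotations))"
    using card_Un_disjoint[OF finY, of "sylow_elements \<union> rotations"] fin[OF sub(1)] fin[OF sub(2)]
      card_Un_disjoint[OF fin[OF sub(1)] fin[OF sub(2)] sylow_elements_rotations] assms(3,4)
    by (simp add: Int_Un_distrib)
  also have "\<dots> \<le> card (G - {1})"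
    using sub assms(1,2) GD(1) by (intro card_mono) auto
  also have "\<dots> = card G - 1" using GD(1,2) by (simp add: card_Diff_singleton)
  finally have "card Y + card sylow_elements + card rotations + 1 \<le> card G"
    using perm_group_card_pos[OF G] by simp
  then show ?thesis using card_sylow_elements card_rotations card_G_eq by simp
qed

text \<open>The elements of order \<open>b\<close> leave \<open>4 * q\<close> others, but
  \<open>2 * b * (q - e) = 2 * b * e * (m - 1)\<close> exceeds \<open>4 * e * m\<close>, because
  \<open>b \<ge> 7\<close> and \<open>m \<ge> 3\<close>.\<close>

lemma normalizer_index_neq_1: "\<not> (normalizer_index = 1 \<and> card sylows = 4 * q)"
proof
  assume "normalizer_index = 1 \<and> card sylows = 4 * q"
  then have "4 * q * (b - 1) + 2 * b * (q - e) + 1 \<le> 4 * b * q" using element_count[of "{}"] by simp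
  moreover have "4 * q * (b - 1) + 4 * q = 4 * b * q"
    using b(2) by (cases b) (simp_all add: algebra_simps)
  ultimately have "2 * b * (q - e) + 1 \<le> 4 * q" by linarith
  moreover have "q - e = e * (m - 1)" using q(1) by (simp add: diff_mult_distrib2)
  moreover have "e * (2 * m) < e * (b * (m - 1))"
  proof -
    have "2 * m < 7 * (m - 1)" using q(4) by linarith
    also have "\<dots> \<le> b * (m - 1)" using b(2) by simp
    finally show ?thesis using q(2) by auto
  qed
  ultimately have "2 * (e * (b * (m - 1))) + 1 \<le> 4 * q" "2 * q < e * (b * (m - 1))"
    by (simp_all add: q(1) ac_simps)
  then show False by linarith
qed

text \<open>In the remaining case \<open>card G = 264\<close>, and two of the twelve normalisers share at most one element outside
  the Sylow subgroups, so that there are at least \<open>11 + 10 + \<dots> + 1\<close> such elements.\<close>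

lemma normalizer_index_neq_2:
  "\<not> (normalizer_index = 2 \<and> card sylows = 12 \<and> b = 11 \<and> q = 6 \<and> e = 2)"
proof
  assume *: "normalizer_index = 2 \<and> card sylows = 12 \<and> b = 11 \<and> q = 6 \<and> e = 2"
  define Y where "Y A = normalizer A - A" for A
  have YG: "Y A \<subseteq> G" for A by (auto simp: Y_def act_stab_def)
  have finY: "finite (Y A)" for A using YG GD(1) finite_subset by blast
  have cN: "card (normalizer A) = 22" if "A \<in> sylows" for A 
  proof -
    have "card (normalizer A) = b * 2" using card_normalizer_eq[OF that] * by metis
    then show ?thesis using * by simp
  qed
  have cY: "card (Y A) = 11" if "A \<in> sylows" for A
    unfolding Y_def using card_Diff_subset[OF perm_groupD(1)[OF sylowsD(1)[OF that]] sylow_subset_normalizer[OF that]]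
      cN[OF that] sylowsD(3)[OF that] * by simp
  have cYY: "card (Y A \<inter> Y A') \<le> 1" if A: "A \<in> sylows" "A' \<in> sylows" "A \<noteq> A'" for A A'
  proof -
    note NG = perm_group_normalizer[OF A(1)] and AD = sylowsD[OF A(1)]
    note actN = acts_on_sylows_minus[OF A(1) subset_refl]
    note actA = acts_on_sylows_minus[OF A(1) sylow_subset_normalizer[OF A(1)]]
    have A': "A' \<in> sylows - {A}" using A by simp
    \<comment> \<open>\<open>A\<close> acts freely on the other conjugates, so \<open>A'\<close> has
      at least 11 images under \<open>normalizer A\<close>, a group of order 22. Its stabiliser
      there has at most two elements, one of them the identity.\<close>
    have "act_stab A conj_set A' = {1}"
      using sylow_semiregular[OF A(1,2) _ _ A(3)] AD(2) perm_groupD(2)[OF AD(1)] acts_onD(1)[OF actA A']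
      by (auto simp: act_stab_def)
    then have "card (act_orbit A conj_set A') = 11"
      using card_orbit_stab[OF AD(1) actA A'] AD(3) * by simp
    moreover have "act_orbit A conj_set A' \<subseteq> act_orbit (normalizer A) conj_set A'"
      using sylow_subset_normalizer[OF A(1)] by (auto simp: act_orbit_def)
    moreover have "finite (act_orbit (normalizer A) conj_set A')"
      using perm_groupD(1)[OF NG] by (simp add: act_orbit_def)
    ultimately have "11 \<le> card (act_orbit (normalizer A) conj_set A')" by (metis card_mono)
    moreover have "card (act_orbit (normalizer A) conj_set A') * card (act_stab (normalizer A) conj_set A') = 22"
      using card_orbit_stab[OF NG actN A'] cN[OF A(1)] by simp
    ultimately have "11 * card (act_stab (normalizer A) conj_set A') \<le> 22" by (metis mult_le_mono1)
    then have c2: "card (act_stab (normalizer A) conj_set A') \<le> 2" by simp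
    note SG = perm_group_stab[OF NG actN A']
    have "Y A \<inter> Y A' \<subseteq> act_stab (normalizer A) conj_set A' - {1}"
      using perm_groupD(2)[OF AD(1)] by (auto simp: Y_def act_stab_def)
    then have "card (Y A \<inter> Y A') \<le> card (act_stab (normalizer A) conj_set A' - {1})"
      using perm_groupD(1)[OF SG] by (intro card_mono) auto
    then show ?thesis using c2 perm_groupD(1,2)[OF SG] by (simp add: card_Diff_singleton)
  qed
  \<comment> \<open>After \<open>k\<close> sets \<open>Y A\<close>, the next one adds at least
    \<open>11 - k\<close> elements, since it meets each earlier one in at most one. The resulting
    bound \<open>(23 * k - k * k) / 2\<close> for \<open>k\<close> sets is written without
    subtraction or division; it is 66 for \<open>k = 12\<close>.\<close>
  have "F \<subseteq> sylows \<Longrightarrow> 23 * card F \<le> 2 * card (\<Union>A\<in>F. Y A) + card F * card F" if "finite F" for F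
    using that
  proof (induction F rule: finite_induct)
    case (insert A F)
    let ?U = "\<Union>A\<in>F. Y A"
    have finU: "finite ?U" using insert.hyps finY by auto
    have "card (Y A \<inter> ?U) \<le> card F"
    proof -
      have "Y A \<inter> ?U = (\<Union>A'\<in>F. Y A \<inter> Y A')" by auto
      also have "card \<dots> \<le> (\<Sum>A'\<in>F. card (Y A \<inter> Y A'))" by (rule card_UN_le[OF insert.hyps(1)])
      also have "\<dots> \<le> (\<Sum>A'\<in>F. 1)" using insert cYY by (intro sum_mono) auto
      finally show ?thesis by simp
    qed
    moreover have "card (Y A) + card ?U = card (Y A \<union> ?U) + card (Y A \<inter> ?U)"
      by (rule card_Un_Int[OF finY finU])
    moreover have "card (Y A) = 11" using cY insert.prems by simp
    moreover have "23 * card F \<le> 2 * card ?U + card F * card F" using insert by simp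
    ultimately show ?case using insert.hyps by simp
  qed simp
  from this[OF finite_sylows] have cU: "66 \<le> card (\<Union>A\<in>sylows. Y A)" using * by simp
  have "card (\<Union>A\<in>sylows. Y A) + card sylows * (b - 1) + 2 * b * (q - e) + 1 \<le> 4 * b * q"
  proof (rule element_count)
    show "(\<Union>A\<in>sylows. Y A) \<subseteq> G" using YG by auto
    show "1 \<notin> (\<Union>A\<in>sylows. Y A)" using sylowsD(1) perm_groupD(2) by (auto simp: Y_def)
    \<comment> \<open>An element of \<open>A'\<close> that normalises \<open>A\<close> has
      \<open>b\<close>-th power 1 and would lie in \<open>A\<close>.\<close>
    have "y \<notin> A'" if "y \<in> Y A" "A \<in> sylows" "A' \<in> sylows" for y A A'
      using normalizer_order_b[OF that(2), of y] sylow_power[OF that(3), of y] that(1) by (auto simp: Y_def)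
    then show "(\<Union>A\<in>sylows. Y A) \<inter> sylow_elements = {}" by (auto simp: sylow_elements_def)
    \<comment> \<open>\<open>A\<close> has index 2 in its normaliser, so \<open>y * y\<close> lies
      in \<open>A\<close>; it fixes \<open>v\<close> along with \<open>y\<close>, and is therefore
      1.\<close>
    have False if y: "y \<in> Y A" and A: "A \<in> sylows" and v: "v \<in> V" "y \<in> fixer v" "y * y \<noteq> 1" for y A v
    proof -
      note NG = perm_group_normalizer[OF A] and AD = sylowsD[OF A]
      have yN: "y \<in> normalizer A" "y \<notin> A" using y by (auto simp: Y_def)
      have "A \<inter> (*) y ` A = {}"
      proof (rule ccontr)
        assume "\<not> ?thesis"
        then obtain a where a: "a \<in> A" "y * a \<in> A" by auto
        then have "y * a * inverse a \<in> A" using perm_groupD(3,4)[OF AD(1)] by blast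
        then show False using yN by (simp add: mult.assoc)
      qed
      then have "card (A \<union> (*) y ` A) = 22"
        using card_Un_disjoint[of A "(*) y ` A"] perm_groupD(1)[OF AD(1)] AD(3) *
        by (simp add: card_image inj_on_def perm.left_cancel)
      moreover have "A \<union> (*) y ` A \<subseteq> normalizer A"
        using sylow_subset_normalizer[OF A] perm_groupD(4)[OF NG yN(1)] by auto
      ultimately have "A \<union> (*) y ` A = normalizer A"
        using card_subset_eq[OF perm_groupD(1)[OF NG]] cN[OF A] by simp
      then have "y * y \<in> A \<union> (*) y ` A" using perm_groupD(4)[OF NG yN(1) yN(1)] by simp
      then have "y * y \<in> A" using yN(2) by (auto simp: perm.left_cancel)
      then show False using sylow_fixpoint_free[OF A _ v(1)] v by (auto simp: fixer_iff apply_times)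
    qed
    then show "(\<Union>A\<in>sylows. Y A) \<inter> rotations = {}" by (auto simp: rotations_def)
  qed
  then show False using cU * by simp
qed

lemma contradiction: False
  using parameters normalizer_index_neq_1 normalizer_index_neq_2 by metis

end

text \<open>Stabilisers have equal order, which determines \<open>q\<close>, and as \<open>m\<close>
  is odd the parity of \<open>q\<close> determines \<open>e\<close>. The values found at one point
  thus hold at all points.\<close>

lemma (in dihedral_primitive) no_dihedral_primitive: False
proof -
  obtain v where v: "v \<in> V" using b by (cases "V = {}") auto
  obtain q e m where q: "card (fixer v) = 2 * q" "q = e * m" "e \<in> {1, 2}" "odd m" "m \<ge> 3"
    "m dvd 2 * b - 1" "q - e \<le> card {x \<in> fixer v. x * x \<noteq> 1}"
    using fixer_order[OF v] by blast
  have card: "card (fixer w) = 2 * q" if "w \<in> V" for w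
    using card_G[OF v] card_G[OF that] q(1) b(2) by simp
  have e: "e = (if even q then 2 else 1)" using q by auto
  have T: "q - e \<le> card {x \<in> fixer w. x * x \<noteq> 1}" if w: "w \<in> V" for w
  proof -
    obtain q' e' m' where q': "card (fixer w) = 2 * q'" "q' = e' * m'" "e' \<in> {1, 2}" "odd m'"
      "q' - e' \<le> card {x \<in> fixer w. x * x \<noteq> 1}"
      using fixer_order[OF w] by blast
    have "q' = q" using q'(1) card[OF w] by simp
    moreover have "e' = (if even q' then 2 else 1)" using q' by auto
    ultimately show ?thesis using q'(5) e by simp
  qed
  have "b dvd card G" using card_G[OF v] by simp
  then obtain x0 where "x0 \<in> G" "card (powers x0) = b" using cauchy_perm[OF G b(1)] by blast
  then interpret dihedral_primitive_sylow G V b x0 q e m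
    by unfold_locales (use card q T in auto)
  show False by (rule contradiction)
qed

section \<open>Flags of a polyhedron\<close>

lemma polytope_auts_compose:
  assumes "f \<in> polytope_auts r" "g \<in> polytope_auts r"
  shows "compose (Field r) f g \<in> polytope_auts r"
proof -
  have "f \<in> Bij (Field r)" "g \<in> Bij (Field r)" using assms by (auto simp: polytope_auts_def)
  then show ?thesis
    using subgroup.m_closed[OF subgroup_polytope_auts assms] by (simp add: BijGroup_def)
qed

lemma polytope_auts_id: "(\<lambda>x\<in>Field r. x) \<in> polytope_auts r"
  using subgroup.one_closed[OF subgroup_polytope_auts, of r] by (simp add: BijGroup_def)

lemma flag_subset_Field: "\<Phi> \<in> flags r \<Longrightarrow> \<Phi> \<subseteq> Field r"
  using Chains_subset_Field' by (auto simp: flags_def)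

lemma flags_image:
  assumes f: "f \<in> polytope_auts r" and \<Phi>: "\<Phi> \<in> flags r"
  shows "f ` \<Phi> \<in> flags r"
proof -
  have chain: "h ` C \<in> Chains r" if h: "h \<in> polytope_auts r" and C: "C \<in> Chains r" for h C
  proof -
    have "(h x, h y) \<in> r \<or> (h y, h x) \<in> r" if "x \<in> C" "y \<in> C" for x y
    proof -
      have "x \<in> Field r" "y \<in> Field r" using that Chains_subset_Field'[OF C] by auto
      then show ?thesis using polytope_autsD(3)[OF h] that C by (simp add: Chains_def)
    qed
    then show ?thesis by (simp add: Chains_def)
  qed
  obtain g where g: "g \<in> polytope_auts r" "\<And>F. F \<in> Field r \<Longrightarrow> f (g F) = F"
    "\<And>F. F \<in> Field r \<Longrightarrow> g (f F) = F" using polytope_aut_inverse[OF f] by blast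
  have "\<Psi> = f ` \<Phi>" if \<Psi>: "\<Psi> \<in> Chains r" "f ` \<Phi> \<subseteq> \<Psi>" for \<Psi>
  proof -
    have gf: "g ` f ` \<Phi> = \<Phi>" using flag_subset_Field[OF \<Phi>] g(3) by (force simp: image_image)
    have fg: "f ` g ` \<Psi> = \<Psi>" using Chains_subset_Field'[OF \<Psi>(1)] g(2) by (force simp: image_image)
    have "\<Phi> \<subseteq> g ` \<Psi>" using \<Psi>(2) gf by blast
    then have "g ` \<Psi> = \<Phi>" using \<Phi> chain[OF g(1) \<Psi>(1)] by (auto simp: flags_def)
    then show ?thesis using fg by simp
  qed
  then show ?thesis using chain[OF f] \<Phi> by (auto simp: flags_def)
qed

text \<open>The poset may be infinite, so a maximal chain containing \<open>C\<close> comes from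
  Zorn's lemma.\<close>

lemma chain_extends_to_flag:
  assumes "C \<in> Chains r"
  obtains \<Phi> where "\<Phi> \<in> flags r" "C \<subseteq> \<Phi>"
proof -
  let ?S = "{X \<in> Chains r. C \<subseteq> X}"
  have "\<exists>M\<in>?S. \<forall>X\<in>?S. M \<subseteq> X \<longrightarrow> X = M"
  proof (rule subset_Zorn_nonempty)
    fix K assume "K \<noteq> {}" and K: "subset.chain ?S K"
    have sub: "K \<subseteq> ?S" and tot: "\<And>X Y. X \<in> K \<Longrightarrow> Y \<in> K \<Longrightarrow> X \<subseteq> Y \<or> Y \<subseteq> X"
      using K by (auto simp: subset_chain_def)
    have "(x, y) \<in> r \<or> (y, x) \<in> r" if "x \<in> X" "X \<in> K" "y \<in> Y" "Y \<in> K" for x y X Y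
    proof -
      have "\<exists>Z\<in>K. x \<in> Z \<and> y \<in> Z" using tot[OF that(2,4)] that by blast
      then show ?thesis using sub by (auto simp: Chains_def)
    qed
    then have "\<Union>K \<in> Chains r" by (auto simp: Chains_def)
    then show "\<Union>K \<in> ?S" using \<open>K \<noteq> {}\<close> sub by blast
  qed (use assms in auto)
  then obtain M where M: "M \<in> ?S" "\<forall>X\<in>?S. M \<subseteq> X \<longrightarrow> X = M" by blast
  have "X = M" if "X \<in> Chains r" "M \<subseteq> X" for X using that M by blast
  then have "M \<in> flags r" using M(1) by (simp add: flags_def)
  then show ?thesis using that M(1) by blast
qed

locale polyhedron =
  fixes r :: "'a rel"
  assumes polytope: "abstract_polytope 3 r"
begin

lemma refl: "F \<in> Field r \<Longrightarrow> (F, F) \<in> r"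
  and trans: "(F, G) \<in> r \<Longrightarrow> (G, H) \<in> r \<Longrightarrow> (F, H) \<in> r"
  and antisym: "(F, G) \<in> r \<Longrightarrow> (G, F) \<in> r \<Longrightarrow> F = G"
proof -
  have "Partial_order r" using polytope by (simp add: abstract_polytope_def)
  then have "refl_on (Field r) r" "Relation.trans r" "Relation.antisym r"
    by (auto simp: partial_order_on_def preorder_on_def)
  then show "F \<in> Field r \<Longrightarrow> (F, F) \<in> r" "(F, G) \<in> r \<Longrightarrow> (G, H) \<in> r \<Longrightarrow> (F, H) \<in> r"
    "(F, G) \<in> r \<Longrightarrow> (G, F) \<in> r \<Longrightarrow> F = G"
    by (auto dest: refl_onD transD antisymD)
qed

lemma card_flag: "\<Phi> \<in> flags r \<Longrightarrow> card \<Phi> = 5"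
  using polytope by (auto simp: abstract_polytope_def)

lemma finite_flag: "\<Phi> \<in> flags r \<Longrightarrow> finite \<Phi>"
  using card_flag card.infinite by fastforce

lemma flag_chain: "\<Phi> \<in> flags r \<Longrightarrow> F \<in> \<Phi> \<Longrightarrow> G \<in> \<Phi> \<Longrightarrow> (F, G) \<in> r \<or> (G, F) \<in> r"
  by (auto simp: flags_def Chains_def)

lemma flag_maximal: "\<Phi> \<in> flags r \<Longrightarrow> C \<in> Chains r \<Longrightarrow> \<Phi> \<subseteq> C \<Longrightarrow> C = \<Phi>"
  by (auto simp: flags_def)

lemma face_in_flag:
  assumes "F \<in> Field r"
  obtains \<Phi> where "\<Phi> \<in> flags r" "F \<in> \<Phi>"
proof -
  have "{F} \<in> Chains r" using refl[OF assms] by (simp add: Chains_def)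
  then show ?thesis using chain_extends_to_flag that by (metis insert_subset)
qed

section \<open>Ranks of faces\<close>

abbreviation lower :: "'a set \<Rightarrow> 'a \<Rightarrow> 'a set" where
  "lower \<Phi> F \<equiv> {G \<in> \<Phi>. (G, F) \<in> r}"

lemma section_chain: "C \<in> Chains (Restr r (under r F)) \<longleftrightarrow> C \<in> Chains r \<and> (\<forall>G\<in>C. (G, F) \<in> r)"
  by (auto simp: Chains_def under_def)

lemma section_flag:
  "\<Phi> \<in> flags (Restr r (under r F)) \<longleftrightarrow> \<Phi> \<in> Chains r \<and> (\<forall>G\<in>\<Phi>. (G, F) \<in> r) \<and>
     (\<forall>\<Psi>. \<Psi> \<in> Chains r \<longrightarrow> (\<forall>G\<in>\<Psi>. (G, F) \<in> r) \<longrightarrow> \<Phi> \<subseteq> \<Psi> \<longrightarrow> \<Psi> = \<Phi>)"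
  unfolding flags_def Ball_def[of "Chains _"] mem_Collect_eq section_chain by (simp add: imp_conjL)

lemma chain_Un:
  assumes "C \<in> Chains r" "\<And>G. G \<in> C \<Longrightarrow> (G, F) \<in> r" "D \<in> Chains r" "\<And>G. G \<in> D \<Longrightarrow> (F, G) \<in> r"
  shows "C \<union> D \<in> Chains r"
proof -
  have "(x, y) \<in> r \<or> (y, x) \<in> r" if "x \<in> C \<union> D" "y \<in> C \<union> D" for x y
    using that assms trans[of x F y] trans[of y F x] by (auto simp: Chains_def)
  then show ?thesis by (simp add: Chains_def)
qed

lemma Chains_subset: "C \<in> Chains r \<Longrightarrow> D \<subseteq> C \<Longrightarrow> D \<in> Chains r"
  by (auto simp: Chains_def)

lemma flag_in_Chains: "\<Phi> \<in> flags r \<Longrightarrow> \<Phi> \<in> Chains r"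
  by (simp add: flags_def)

lemma flag_split:
  assumes "\<Phi> \<in> flags r" "F \<in> \<Phi>"
  shows "\<Phi> = lower \<Phi> F \<union> {G \<in> \<Phi>. (F, G) \<in> r}"
  using flag_chain[OF assms(1) _ assms(2)] by blast

lemma lower_flag:
  assumes "\<Phi> \<in> flags r" "F \<in> \<Phi>"
  shows "lower \<Phi> F \<in> flags (Restr r (under r F))"
proof -
  have "\<Psi> = lower \<Phi> F" if \<Psi>: "\<Psi> \<in> Chains r" "\<forall>G\<in>\<Psi>. (G, F) \<in> r" "lower \<Phi> F \<subseteq> \<Psi>" for \<Psi>
  proof -
    have "\<Psi> \<union> {G \<in> \<Phi>. (F, G) \<in> r} \<in> Chains r"
      using \<Psi> Chains_subset[OF flag_in_Chains[OF assms(1)], of "{G \<in> \<Phi>. (F, G) \<in> r}"]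
      by (intro chain_Un[where F = F]) auto
    moreover have "\<Phi> \<subseteq> \<Psi> \<union> {G \<in> \<Phi>. (F, G) \<in> r}" using flag_split[OF assms] \<Psi>(3) by blast
    ultimately have "\<Psi> \<union> {G \<in> \<Phi>. (F, G) \<in> r} = \<Phi>" by (rule flag_maximal[OF assms(1)])
    then show ?thesis using \<Psi>(2,3) by blast
  qed
  moreover have "lower \<Phi> F \<in> Chains r"
    using Chains_subset[OF flag_in_Chains[OF assms(1)], of "lower \<Phi> F"] by simp
  ultimately show ?thesis unfolding section_flag by simp
qed

text \<open>Exchanging the part of \<open>\<Phi>\<close> below \<open>F\<close> for
  \<open>\<Psi>\<close> gives another flag, and both have five faces. So all flags of the section
  have one size, and a rank can be read off from any flag through \<open>F\<close>.\<close>

lemma card_section_flag: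
  assumes "\<Phi> \<in> flags r" "F \<in> \<Phi>" "\<Psi> \<in> flags (Restr r (under r F))"
  shows "card \<Psi> = card (lower \<Phi> F)"
proof -
  let ?H = "{G \<in> \<Phi>. (F, G) \<in> r \<and> G \<noteq> F}"
  have \<Psi>: "\<Psi> \<in> Chains r" "\<forall>G\<in>\<Psi>. (G, F) \<in> r"
    "\<And>C. C \<in> Chains r \<Longrightarrow> \<forall>G\<in>C. (G, F) \<in> r \<Longrightarrow> \<Psi> \<subseteq> C \<Longrightarrow> C = \<Psi>"
    using assms(3) unfolding section_flag by auto
  have FF: "(F, F) \<in> r" using refl flag_subset_Field assms by blast
  have "insert F \<Psi> \<in> Chains r" using \<Psi>(1,2) FF by (auto simp: Chains_def)
  then have "insert F \<Psi> = \<Psi>" using \<Psi>(2) FF by (intro \<Psi>(3)) auto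
  then have F: "F \<in> \<Psi>" by blast
  have X: "\<Psi> \<union> ?H \<in> flags r"
  proof -
    have "\<Psi> \<union> ?H \<in> Chains r"
      using \<Psi> Chains_subset[OF flag_in_Chains[OF assms(1)], of ?H] by (intro chain_Un[where F = F]) auto
    moreover have "C = \<Psi> \<union> ?H" if C: "C \<in> Chains r" "\<Psi> \<union> ?H \<subseteq> C" for C
    proof -
      have cmp: "(G, F) \<in> r \<or> (F, G) \<in> r" if "G \<in> C" for G using C F that by (auto simp: Chains_def)
      have "{G \<in> C. (G, F) \<in> r} = \<Psi>"
        using C \<Psi>(2) Chains_subset[OF C(1), of "{G \<in> C. (G, F) \<in> r}"] by (intro \<Psi>(3)) auto
      moreover have "lower \<Phi> F \<union> {G \<in> C. (F, G) \<in> r} = \<Phi>"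
      proof (rule flag_maximal[OF assms(1)])
        show "lower \<Phi> F \<union> {G \<in> C. (F, G) \<in> r} \<in> Chains r"
          using Chains_subset[OF C(1), of "{G \<in> C. (F, G) \<in> r}"]
            Chains_subset[OF flag_in_Chains[OF assms(1)], of "lower \<Phi> F"]
          by (intro chain_Un[where F = F]) auto
        show "\<Phi> \<subseteq> lower \<Phi> F \<union> {G \<in> C. (F, G) \<in> r}"
          using flag_split[OF assms(1,2)] C(2) F FF by blast
      qed
      ultimately show ?thesis using cmp C(2) F by blast
    qed
    ultimately show ?thesis unfolding flags_def by blast
  qed
  have disj: "X \<inter> ?H = {}" if "\<forall>G\<in>X. (G, F) \<in> r" for X
  proof (rule equals0I)
    fix G assume "G \<in> X \<inter> ?H"
    then have "(G, F) \<in> r" "(F, G) \<in> r" "G \<noteq> F" using that by auto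
    then show False using antisym[of G F] by simp
  qed
  have "card \<Psi> + card ?H = 5"
    using card_flag[OF X] finite_flag[OF X] card_Un_disjoint[of \<Psi> ?H] disj[OF \<Psi>(2)] by simp
  moreover have "lower \<Phi> F \<inter> ?H = {}" by (rule disj) simp
  moreover have "\<Phi> = lower \<Phi> F \<union> ?H" using flag_split[OF assms(1,2)] FF by blast
  ultimately show ?thesis
    using card_flag[OF assms(1)] finite_flag[OF assms(1)] card_Un_disjoint[of "lower \<Phi> F" ?H] by simp
qed

lemma faces_of_rank_iff:
  assumes "\<Phi> \<in> flags r" "F \<in> \<Phi>"
  shows "F \<in> faces_of_rank r i \<longleftrightarrow> int (card (lower \<Phi> F)) = i + 2"
proof
  assume "F \<in> faces_of_rank r i"
  then show "int (card (lower \<Phi> F)) = i + 2" using lower_flag[OF assms] by (simp add: faces_of_rank_def)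
next
  assume "int (card (lower \<Phi> F)) = i + 2"
  then have "int (card \<Psi>) = i + 2" if "\<Psi> \<in> flags (Restr r (under r F))" for \<Psi>
    using card_section_flag[OF assms that] by simp
  then show "F \<in> faces_of_rank r i"
    using flag_subset_Field[OF assms(1)] assms(2) by (auto simp: faces_of_rank_def)
qed

lemma rank_exists:
  assumes "\<Phi> \<in> flags r" "F \<in> \<Phi>"
  obtains i where "F \<in> faces_of_rank r i" "i \<in> {-1..3}"
proof
  \<comment> \<open>\<open>lower \<Phi> F\<close> includes \<open>F\<close> itself and ranks start
    at -1, hence the offset 2: sizes 1 to 5 are ranks -1 to 3.\<close>
  let ?i = "int (card (lower \<Phi> F)) - 2"
  have "lower \<Phi> F \<noteq> {}" using refl flag_subset_Field assms by blast
  then have "card (lower \<Phi> F) > 0" using finite_flag[OF assms(1)] by (simp add: card_gt_0_iff)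
  moreover have "card (lower \<Phi> F) \<le> 5"
    using card_mono[OF finite_flag[OF assms(1)], of "lower \<Phi> F"] card_flag[OF assms(1)] by auto
  ultimately show "?i \<in> {-1..3}" by auto
  show "F \<in> faces_of_rank r ?i" using faces_of_rank_iff[OF assms] by simp
qed

lemma rank_inj:
  assumes "\<Phi> \<in> flags r" "F \<in> \<Phi>" "G \<in> \<Phi>" "F \<in> faces_of_rank r i" "G \<in> faces_of_rank r i"
  shows "F = G"
proof -
  have le: "H = K" if "H \<in> \<Phi>" "K \<in> \<Phi>" "(H, K) \<in> r" "card (lower \<Phi> H) = card (lower \<Phi> K)" for H K
  proof -
    have "lower \<Phi> H \<subseteq> lower \<Phi> K" using that(3) trans by blast
    then have "lower \<Phi> H = lower \<Phi> K" using that(4) finite_flag[OF assms(1)] by (simp add: card_subset_eq)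
    moreover have "K \<in> lower \<Phi> K" using that(2) refl flag_subset_Field[OF assms(1)] by blast
    ultimately show ?thesis using antisym that(3) by blast
  qed
  have "card (lower \<Phi> F) = card (lower \<Phi> G)"
    using assms(4,5) faces_of_rank_iff[OF assms(1,2)] faces_of_rank_iff[OF assms(1,3)] by simp
  then show ?thesis using flag_chain[OF assms(1-3)] le[of F G] le[of G F] assms(2,3) by auto
qed

lemma rank_unique:
  assumes "F \<in> faces_of_rank r i" "F \<in> faces_of_rank r j"
  shows "i = j"
proof -
  have "F \<in> Field r" using assms by (simp add: faces_of_rank_def)
  then obtain \<Phi> where "\<Phi> \<in> flags r" "F \<in> \<Phi>" using face_in_flag by blast
  then show ?thesis using assms faces_of_rank_iff by simp
qed

text \<open>The five faces of a flag have distinct ranks among five possible values, so every value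
  occurs.\<close>

lemma flag_face_of_rank:
  assumes "\<Phi> \<in> flags r" "i \<in> {-1..3}"
  obtains F where "F \<in> \<Phi>" "F \<in> faces_of_rank r i"
proof -
  define rk where "rk F = (THE i. F \<in> faces_of_rank r i)" for F
  have rk: "F \<in> faces_of_rank r (rk F)" "rk F \<in> {-1..3}" if F: "F \<in> \<Phi>" for F
  proof -
    obtain j where j: "F \<in> faces_of_rank r j" "j \<in> {-1..3}" using rank_exists[OF assms(1) F] .
    have "rk F = j" unfolding rk_def using j(1) rank_unique by blast
    then show "F \<in> faces_of_rank r (rk F)" "rk F \<in> {-1..3}" using j by simp_all
  qed
  have "inj_on rk \<Phi>" using rk(1) rank_inj[OF assms(1)] by (metis inj_onI)
  then have "card (rk ` \<Phi>) = card {-1..3::int}" using card_flag[OF assms(1)] by (simp add: card_image)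
  then have "rk ` \<Phi> = {-1..3}" using rk(2) by (intro card_subset_eq) auto
  then show ?thesis using assms(2) rk(1) that by (metis imageE)
qed

section \<open>Adjacent flags and the rank of the exchanged face\<close>

definition adj :: "int \<Rightarrow> 'a set \<Rightarrow> 'a set \<Rightarrow> bool" where
  "adj i \<Phi> \<Psi> \<longleftrightarrow> \<Phi> \<in> flags r \<and> \<Psi> \<in> flags r \<and>
     (\<exists>F F'. \<Phi> - \<Psi> = {F} \<and> \<Psi> - \<Phi> = {F'} \<and> F \<in> faces_of_rank r i \<and> F' \<in> faces_of_rank r i)"

lemma adj_sym: "adj i \<Phi> \<Psi> \<Longrightarrow> adj i \<Psi> \<Phi>"
  by (auto simp: adj_def)

lemma least_greatest:
  obtains L U where "\<And>\<Phi>. \<Phi> \<in> flags r \<Longrightarrow> L \<in> \<Phi> \<and> L \<in> faces_of_rank r (-1)"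
    "\<And>\<Phi>. \<Phi> \<in> flags r \<Longrightarrow> U \<in> \<Phi> \<and> U \<in> faces_of_rank r 3"
proof -
  obtain L U where LU: "L \<in> Field r" "\<forall>F\<in>Field r. (L, F) \<in> r" "U \<in> Field r" "\<forall>F\<in>Field r. (F, U) \<in> r"
    using polytope by (auto simp: abstract_polytope_def)
  have "L \<in> \<Phi> \<and> L \<in> faces_of_rank r (-1) \<and> U \<in> \<Phi> \<and> U \<in> faces_of_rank r 3" if \<Phi>: "\<Phi> \<in> flags r" for \<Phi>
  proof -
    note sub = flag_subset_Field[OF \<Phi>]
    have "insert L (insert U \<Phi>) \<in> Chains r"
      using flag_in_Chains[OF \<Phi>] LU sub by (auto simp: Chains_def)
    then have "insert L (insert U \<Phi>) = \<Phi>" by (rule flag_maximal[OF \<Phi>]) blast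
    then have mem: "L \<in> \<Phi>" "U \<in> \<Phi>" by blast+
    have "lower \<Phi> L = {L}" using mem LU sub antisym by blast
    moreover have "lower \<Phi> U = \<Phi>" using LU sub by blast
    ultimately show ?thesis
      using mem faces_of_rank_iff[OF \<Phi> mem(1)] faces_of_rank_iff[OF \<Phi> mem(2)] card_flag[OF \<Phi>] by simp
  qed
  then show ?thesis using that by blast
qed

text \<open>The face of \<open>\<Psi>\<close> that has the rank of \<open>F\<close> cannot belong to
  \<open>\<Phi>\<close>, where \<open>F\<close> is the only face of that rank; so the exchanged
  faces have equal rank. Ranks -1 and 3 are excluded because the least and greatest faces lie in
  every flag.\<close>

lemma adjacent_flags_adj:
  assumes "\<Phi> \<in> flags r" "\<Psi> \<in> flags r" "adjacent_flags \<Phi> \<Psi>"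
  obtains i where "i \<in> {0, 1, 2}" "adj i \<Phi> \<Psi>"
proof -
  obtain F F' where F: "\<Phi> - \<Psi> = {F}" and F': "\<Psi> - \<Phi> = {F'}"
    using assms(3) by (auto simp: adjacent_flags_def card_1_singleton_iff)
  obtain i where i: "F \<in> faces_of_rank r i" "i \<in> {-1..3}" using rank_exists[OF assms(1), of F] F by blast
  obtain G where G: "G \<in> \<Psi>" "G \<in> faces_of_rank r i" using flag_face_of_rank[OF assms(2) i(2)] by blast
  have "G = F'"
  proof (rule ccontr)
    assume "G \<noteq> F'"
    then have "G \<in> \<Phi>" using F' G by blast
    then have "G = F" using rank_inj[OF assms(1)] F G i by blast
    then show False using G F by blast
  qed
  then have "adj i \<Phi> \<Psi>" using assms F F' i G by (auto simp: adj_def)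
  moreover have "i \<noteq> -1 \<and> i \<noteq> 3"
    using least_greatest rank_inj[OF assms(1)] i F assms by (metis DiffD1 DiffD2 insertI1)
  then have "i \<in> {0, 1, 2}" using i(2) by auto
  ultimately show ?thesis using that by blast
qed

text \<open>By the diamond condition exactly two faces of rank \<open>i\<close> lie between the
  faces \<open>B\<close> and \<open>T\<close> of \<open>\<Phi>\<close> in the neighbouring ranks.
  One is \<open>F\<close>, so the replacements \<open>G\<close> and \<open>G'\<close> are both the
  other.\<close>

lemma adj_unique:
  assumes "adj i \<Phi> \<Psi>" "adj i \<Phi> \<Psi>'" "i \<in> {0, 1, 2}"
  shows "\<Psi> = \<Psi>'"
proof -
  obtain F G where F: "\<Phi> - \<Psi> = {F}" "\<Psi> - \<Phi> = {G}" "F \<in> faces_of_rank r i" "G \<in> faces_of_rank r i"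
    and fl: "\<Phi> \<in> flags r" "\<Psi> \<in> flags r" using assms(1) by (auto simp: adj_def)
  obtain F' G' where F': "\<Phi> - \<Psi>' = {F'}" "\<Psi>' - \<Phi> = {G'}" "F' \<in> faces_of_rank r i" "G' \<in> faces_of_rank r i"
    and fl': "\<Psi>' \<in> flags r" using assms(2) by (auto simp: adj_def)
  have "F' = F" using rank_inj[OF fl(1)] F F' by blast
  have ranks: "i - 1 \<in> {-1..3}" "i + 1 \<in> {-1..3}" using assms(3) by auto
  obtain B where B: "B \<in> \<Phi>" "B \<in> faces_of_rank r (i - 1)" using flag_face_of_rank[OF fl(1) ranks(1)] .
  obtain T where T: "T \<in> \<Phi>" "T \<in> faces_of_rank r (i + 1)" using flag_face_of_rank[OF fl(1) ranks(2)] .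
  let ?D = "{H \<in> faces_of_rank r i. (B, H) \<in> r \<and> (H, T) \<in> r}"
  have order: "(B, H) \<in> r \<and> (H, T) \<in> r" if X: "X \<in> flags r" "B \<in> X" "T \<in> X" "H \<in> X" "H \<in> faces_of_rank r i" for X H
  proof -
    have le: "(H1, H2) \<in> r" if "H1 \<in> X" "H2 \<in> X" "H1 \<in> faces_of_rank r j" "H2 \<in> faces_of_rank r k" "j < k" for H1 H2 j k
    proof (rule ccontr)
      assume "(H1, H2) \<notin> r"
      then have "(H2, H1) \<in> r" using flag_chain[OF X(1)] that by blast
      then have "lower X H2 \<subseteq> lower X H1" using trans by blast
      then have "card (lower X H2) \<le> card (lower X H1)" using finite_flag[OF X(1)] by (intro card_mono) auto
      then show False
        using faces_of_rank_iff[OF X(1) that(1), of j] faces_of_rank_iff[OF X(1) that(2), of k] that(3-5) by linarith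
    qed
    show ?thesis using le[OF X(2,4) B(2) X(5)] le[OF X(4,3) X(5) T(2)] by simp
  qed
  have ne: "B \<noteq> F" "T \<noteq> F" 
    using B T F(3) rank_unique[of F i "i - 1"] rank_unique[of F i "i + 1"] by auto
  have inX: "B \<in> \<Psi>" "T \<in> \<Psi>" "B \<in> \<Psi>'" "T \<in> \<Psi>'" using ne B T F(1) F'(1) \<open>F' = F\<close> by blast+
  have two: "x = y" if "card D = 2" "z \<in> D" "x \<in> D" "y \<in> D" "x \<noteq> z" "y \<noteq> z" for x y z :: 'a and D
    using that by (auto simp: card_2_iff)
  have "card ?D = 2"
  proof -
    have "(B, T) \<in> r" using order[OF fl(1) B(1) T(1), of F] F trans[of B F T] by blast
    moreover have "i \<in> {0..<int 3}" using assms(3) by auto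
    moreover have "\<forall>i \<in> {0..<int 3}. \<forall>F \<in> faces_of_rank r (i - 1). \<forall>G \<in> faces_of_rank r (i + 1).
        (F, G) \<in> r \<longrightarrow> card {H \<in> faces_of_rank r i. (F, H) \<in> r \<and> (H, G) \<in> r} = 2"
      using polytope unfolding abstract_polytope_def by (elim conjE)
    ultimately show ?thesis using B(2) T(2) by blast
  qed
  moreover have "F \<in> ?D" using order[OF fl(1) B(1) T(1), of F] F by blast
  moreover have "G \<in> ?D" using order[OF fl(2) inX(1,2), of G] F by blast
  moreover have "G' \<in> ?D" using order[OF fl' inX(3,4), of G'] F' by blast
  moreover have "G \<noteq> F" "G' \<noteq> F" using F F' by blast+
  ultimately have "G = G'" using two by blast
  then show ?thesis using F F' \<open>F' = F\<close> by blast
qed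

end

lemma image_restrict_id: "\<Phi> \<subseteq> A \<Longrightarrow> (\<lambda>x\<in>A. x) ` \<Phi> = \<Phi>"
  using image_cong[of \<Phi> \<Phi> "\<lambda>x\<in>A. x" "\<lambda>x. x"] by auto

lemma image_inverse_cancel:
  assumes "\<Phi> \<subseteq> A" "\<And>x. x \<in> A \<Longrightarrow> k (h x) = x"
  shows "k ` h ` \<Phi> = \<Phi>"
proof -
  have "(\<lambda>x. k (h x)) ` \<Phi> = (\<lambda>x. x) ` \<Phi>" by (rule image_cong) (use assms in auto)
  then show ?thesis by (simp add: image_image)
qed

lemma image_compose_restrict: "\<Phi> \<subseteq> A \<Longrightarrow> compose A f g ` \<Phi> = f ` g ` \<Phi>"
  unfolding image_image by (rule image_cong) (auto simp: compose_eq)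

context polyhedron
begin

lemma adj_image:
  assumes f: "f \<in> polytope_auts r" and "adj i \<Phi> \<Psi>"
  shows "adj i (f ` \<Phi>) (f ` \<Psi>)"
proof -
  obtain F F' where F: "\<Phi> - \<Psi> = {F}" "\<Psi> - \<Phi> = {F'}" "F \<in> faces_of_rank r i" "F' \<in> faces_of_rank r i"
    and fl: "\<Phi> \<in> flags r" "\<Psi> \<in> flags r" using assms(2) by (auto simp: adj_def)
  have inj: "inj_on f (Field r)" using polytope_autsD(1)[OF f] by (simp add: bij_betw_def)
  have "f ` \<Phi> - f ` \<Psi> = f ` (\<Phi> - \<Psi>)" "f ` \<Psi> - f ` \<Phi> = f ` (\<Psi> - \<Phi>)"
    using inj_on_image_set_diff[OF inj, of \<Phi> \<Psi>] inj_on_image_set_diff[OF inj, of \<Psi> \<Phi>]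
      flag_subset_Field[OF fl(1)] flag_subset_Field[OF fl(2)] by auto
  then have "f ` \<Phi> - f ` \<Psi> = {f F}" "f ` \<Psi> - f ` \<Phi> = {f F'}" using F by simp_all
  then show ?thesis
    using flags_image[OF f fl(1)] flags_image[OF f fl(2)] faces_of_rank_image[OF f F(3)] faces_of_rank_image[OF f F(4)]
    unfolding adj_def by blast
qed

lemma flag_pointwise:
  assumes f: "f \<in> polytope_auts r" and g: "g \<in> polytope_auts r" and \<Phi>: "\<Phi> \<in> flags r"
    and eq: "f ` \<Phi> = g ` \<Phi>" and x: "x \<in> \<Phi>"
  shows "f x = g x"
proof -
  obtain i where i: "x \<in> faces_of_rank r i" using rank_exists[OF \<Phi> x] .
  show ?thesis
    using rank_inj[OF flags_image[OF f \<Phi>] _ _ faces_of_rank_image[OF f i] faces_of_rank_image[OF g i]] x eq by blast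
qed

lemma connected:
  assumes "\<Phi> \<in> flags r" "\<Psi> \<in> flags r"
  shows "(\<Phi>, \<Psi>) \<in> {(\<Phi>', \<Psi>'). \<Phi>' \<in> flags r \<and> \<Psi>' \<in> flags r \<and>
    \<Phi> \<inter> \<Psi> \<subseteq> \<Phi>' \<and> \<Phi> \<inter> \<Psi> \<subseteq> \<Psi>' \<and> adjacent_flags \<Phi>' \<Psi>'}\<^sup>*"
proof -
  have "strongly_flag_connected r" using polytope unfolding abstract_polytope_def by (elim conjE)
  then show ?thesis using assms unfolding strongly_flag_connected_def by blast
qed

text \<open>Automorphisms preserve \<open>adj i\<close> and the \<open>i\<close>-adjacent flag is
  unique, so agreement on one flag spreads along adjacent flags to all. Equal images of a flag mean
  pointwise equality, as there is one face per rank.\<close>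

lemma aut_eqI:
  assumes f: "f \<in> polytope_auts r" and g: "g \<in> polytope_auts r" and \<Phi>: "\<Phi> \<in> flags r"
    and eq: "f ` \<Phi> = g ` \<Phi>" and x: "x \<in> Field r"
  shows "f x = g x"
proof -
  obtain \<Psi> where \<Psi>: "\<Psi> \<in> flags r" "x \<in> \<Psi>" using face_in_flag[OF x] .
  have "f ` \<Psi> = g ` \<Psi>" using connected[OF \<Phi> \<Psi>(1)]
  proof (induction rule: rtrancl_induct)
    case (step \<Psi>1 \<Psi>2)
    then have fl: "\<Psi>1 \<in> flags r" "\<Psi>2 \<in> flags r" "adjacent_flags \<Psi>1 \<Psi>2" by auto
    obtain i where i: "i \<in> {0, 1, 2}" "adj i \<Psi>1 \<Psi>2" using adjacent_flags_adj[OF fl] .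
    show ?case
      using adj_unique[OF _ _ i(1)] adj_image[OF f i(2)] adj_image[OF g i(2)] step.IH by metis
  qed (rule eq)
  then show ?thesis using flag_pointwise[OF f g \<Psi>(1) _ \<Psi>(2)] by blast
qed

lemma vertex_adj:
  assumes "adj i \<Phi> \<Psi>" "i \<noteq> 0" "v \<in> vertices r" "v \<in> \<Phi>"
  shows "v \<in> \<Psi>"
proof (rule ccontr)
  assume "v \<notin> \<Psi>"
  obtain F where F: "\<Phi> - \<Psi> = {F}" "F \<in> faces_of_rank r i" using assms(1) by (auto simp: adj_def)
  then have "v = F" using \<open>v \<notin> \<Psi>\<close> assms(4) by blast
  then show False using rank_unique[OF F(2), of 0] assms(2,3) by (simp add: vertices_def)
qed

lemma vertex_in_flag_unique:
  "\<Phi> \<in> flags r \<Longrightarrow> v \<in> \<Phi> \<Longrightarrow> w \<in> \<Phi> \<Longrightarrow> v \<in> vertices r \<Longrightarrow> w \<in> vertices r \<Longrightarrow> v = w"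
  unfolding vertices_def by (rule rank_inj)

end

section \<open>The permutation group on the vertices\<close>

definition vertex_perm :: "'a rel \<Rightarrow> ('a \<Rightarrow> 'a) \<Rightarrow> 'a perm" where
  "vertex_perm r f = Perm (\<lambda>x. if x \<in> vertices r then f x else x)"

locale finite_regular_polyhedron = polyhedron +
  assumes regular: "\<And>\<Phi> \<Psi>. \<Phi> \<in> flags r \<Longrightarrow> \<Psi> \<in> flags r \<Longrightarrow> \<exists>f\<in>polytope_auts r. f ` \<Phi> = \<Psi>"
    and finite_vertices: "finite (vertices r)"
begin

lemma vertices_subset: "vertices r \<subseteq> Field r"
  by (auto simp: vertices_def faces_of_rank_def)

lemma aut_vertex: "f \<in> polytope_auts r \<Longrightarrow> x \<in> vertices r \<Longrightarrow> f x \<in> vertices r"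
  using faces_of_rank_image by (auto simp: vertices_def)

lemma vertex_map_permutes:
  assumes f: "f \<in> polytope_auts r"
  shows "(\<lambda>x. if x \<in> vertices r then f x else x) permutes vertices r"
proof (rule bij_imp_permutes)
  have inj: "inj_on f (vertices r)"
    using polytope_autsD(1)[OF f] vertices_subset inj_on_subset by (auto simp: bij_betw_def)
  moreover have "f ` vertices r \<subseteq> vertices r" using aut_vertex[OF f] by blast
  ultimately have "bij_betw f (vertices r) (vertices r)"
    using endo_inj_surj[OF finite_vertices] by (simp add: bij_betw_def)
  then show "bij_betw (\<lambda>x. if x \<in> vertices r then f x else x) (vertices r) (vertices r)"
    by (simp cong: bij_betw_cong)
qed simp

text \<open>\<open>Perm\<close> is meaningful only for bijections of finite support; extending by
  the identity off the finite vertex set ensures both properties.\<close>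

lemma apply_vertex_perm:
  assumes f: "f \<in> polytope_auts r"
  shows "vertex_perm r f \<langle>$\<rangle> x = (if x \<in> vertices r then f x else x)"
proof -
  have "finite {x. (if x \<in> vertices r then f x else x) \<noteq> x}"
    by (rule finite_subset[OF _ finite_vertices]) (auto split: if_splits)
  then have "(\<lambda>x. if x \<in> vertices r then f x else x) \<in> {f. bij f \<and> finite {a. f a \<noteq> a}}"
    using permutes_bij[OF vertex_map_permutes[OF f]] by simp
  then show ?thesis unfolding vertex_perm_def by (simp only: Perm_inverse)
qed

lemma vertex_perm_compose:
  assumes "f \<in> polytope_auts r" "g \<in> polytope_auts r"
  shows "vertex_perm r (compose (Field r) f g) = vertex_perm r f * vertex_perm r g"
proof (rule perm_eqI)
  fix x
  show "vertex_perm r (compose (Field r) f g) \<langle>$\<rangle> x = (vertex_perm r f * vertex_perm r g) \<langle>$\<rangle> x"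
    using aut_vertex[OF assms(2), of x] vertices_subset
    by (auto simp: apply_times apply_vertex_perm[OF assms(1)] apply_vertex_perm[OF assms(2)]
        apply_vertex_perm[OF polytope_auts_compose[OF assms]] compose_eq subset_iff)
qed

lemma vertex_perm_eqI:
  assumes "f \<in> polytope_auts r" "g \<in> polytope_auts r" "\<Phi> \<in> flags r" "f ` \<Phi> = g ` \<Phi>"
  shows "vertex_perm r f = vertex_perm r g"
proof (rule perm_eqI)
  fix x
  have "f x = g x" if "x \<in> vertices r" using aut_eqI[OF assms] that vertices_subset by blast
  then show "vertex_perm r f \<langle>$\<rangle> x = vertex_perm r g \<langle>$\<rangle> x"
    by (simp add: apply_vertex_perm[OF assms(1)] apply_vertex_perm[OF assms(2)])
qed

lemma vertex_perm_id: "vertex_perm r (\<lambda>x\<in>Field r. x) = 1"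
proof (rule perm_eqI)
  fix x
  have "x \<in> Field r" if "x \<in> vertices r" using that vertices_subset by blast
  then show "vertex_perm r (\<lambda>x\<in>Field r. x) \<langle>$\<rangle> x = 1 \<langle>$\<rangle> x"
    by (simp add: apply_vertex_perm[OF polytope_auts_id])
qed

definition vertex_group :: "'a perm set" where
  "vertex_group = vertex_perm r ` polytope_auts r"

lemma perm_group_vertex_group: "perm_group vertex_group"
  unfolding perm_group_def
proof (intro conjI ballI)
  show "1 \<in> vertex_group" using polytope_auts_id vertex_perm_id unfolding vertex_group_def by (metis imageI)
  have "vertex_group \<subseteq> Perm ` {f. f permutes vertices r}"
    unfolding vertex_group_def vertex_perm_def using vertex_map_permutes by blast
  then show "finite vertex_group"
    using finite_permutations[OF finite_vertices] by (meson finite_imageI finite_subset)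
  fix p assume p: "p \<in> vertex_group"
  then obtain f where f: "f \<in> polytope_auts r" "p = vertex_perm r f" by (auto simp: vertex_group_def)
  obtain g where g: "g \<in> polytope_auts r" "\<And>F. F \<in> Field r \<Longrightarrow> f (g F) = F"
    "\<And>F. F \<in> Field r \<Longrightarrow> g (f F) = F" using polytope_aut_inverse[OF f(1)] by blast
  have "vertex_perm r f * vertex_perm r g = 1"
  proof (rule perm_eqI)
    fix x
    have "f (g x) = x" "g x \<in> vertices r" if "x \<in> vertices r"
      using g(2)[of x] aut_vertex[OF g(1) that] that vertices_subset by blast+
    then show "(vertex_perm r f * vertex_perm r g) \<langle>$\<rangle> x = 1 \<langle>$\<rangle> x"
      by (simp add: apply_times apply_vertex_perm[OF f(1)] apply_vertex_perm[OF g(1)])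
  qed
  then have "inverse p = vertex_perm r g" using f(2) by (simp add: perm.inverse_unique)
  then show "inverse p \<in> vertex_group" using g(1) by (simp add: vertex_group_def)
  fix p' assume "p' \<in> vertex_group"
  then obtain f' where f': "f' \<in> polytope_auts r" "p' = vertex_perm r f'" by (auto simp: vertex_group_def)
  show "p * p' \<in> vertex_group"
    using vertex_perm_compose[OF f(1) f'(1)] polytope_auts_compose[OF f(1) f'(1)] f f'
    unfolding vertex_group_def by (metis imageI)
qed

text \<open>These are the distinguished generators of a regular polyhedron. An automorphism taking
  \<open>\<Phi>\<close> to its \<open>i\<close>-adjacent flag takes that flag back to
  \<open>\<Phi>\<close> by uniqueness, so its square fixes a flag and hence every face.\<close>

lemma adjacency_aut:
  assumes "\<Phi> \<in> flags r" "i \<in> {0, 1, 2}"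
  obtains f where "f \<in> polytope_auts r" "vertex_perm r f * vertex_perm r f = 1"
    "\<And>\<Psi>. adj i \<Phi> \<Psi> \<Longrightarrow> f ` \<Phi> = \<Psi>" "f ` \<Phi> = \<Phi> \<or> adj i \<Phi> (f ` \<Phi>)"
proof (cases "\<exists>\<Psi>. adj i \<Phi> \<Psi>")
  case True
  then obtain \<Psi> where \<Psi>: "adj i \<Phi> \<Psi>" by blast
  then have "\<Psi> \<in> flags r" by (simp add: adj_def)
  then obtain f where f: "f \<in> polytope_auts r" "f ` \<Phi> = \<Psi>" using regular[OF assms(1)] by blast
  have "adj i (f ` \<Phi>) (f ` \<Psi>)" using adj_image[OF f(1) \<Psi>] .
  then have f': "f ` \<Psi> = \<Phi>" using adj_unique[OF _ adj_sym[OF \<Psi>] assms(2)] f(2) by blast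
  note sub = flag_subset_Field[OF assms(1)]
  have "compose (Field r) f f ` \<Phi> = (\<lambda>x\<in>Field r. x) ` \<Phi>"
    unfolding image_compose_restrict[OF sub] image_restrict_id[OF sub] f(2) f' ..
  then have "vertex_perm r f * vertex_perm r f = 1"
    using vertex_perm_eqI[OF polytope_auts_compose[OF f(1) f(1)] polytope_auts_id assms(1)]
      vertex_perm_compose[OF f(1) f(1)] vertex_perm_id by simp
  then show ?thesis using that[OF f(1)] f(2) \<Psi> adj_unique[OF \<Psi> _ assms(2)] by blast
next
  case False
  \<comment> \<open>The identity is the default value when no \<open>i\<close>-adjacent flag is at
    hand; it meets the last clause by fixing \<open>\<Phi>\<close>.\<close>
  have "(\<lambda>x\<in>Field r. x) ` \<Phi> = \<Phi>" by (rule image_restrict_id[OF flag_subset_Field[OF assms(1)]])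
  then show ?thesis using that[OF polytope_auts_id] False vertex_perm_id by simp
qed

lemma vertex_fixed:
  assumes "\<Phi> \<in> flags r" "i \<in> {1, 2}" "v \<in> vertices r" "v \<in> \<Phi>" "f \<in> polytope_auts r"
    "f ` \<Phi> = \<Phi> \<or> adj i \<Phi> (f ` \<Phi>)"
  shows "f v = v"
proof -
  have "v \<in> f ` \<Phi>" using assms vertex_adj[of i \<Phi> "f ` \<Phi>" v] by auto
  then show ?thesis
    using vertex_in_flag_unique[OF flags_image[OF assms(5,1)]] aut_vertex[OF assms(5,3)] assms(3,4) by blast
qed

text \<open>An automorphism fixing \<open>v\<close> sends a flag through \<open>v\<close> to another
  one, and strong connectedness joins the two by flags that all contain \<open>v\<close>. Each step
  exchanges a face of rank 1 or 2 and, transported to the base flag, is realised by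
  \<open>f1\<close> or \<open>f2\<close>.\<close>

lemma stabiliser_generated:
  assumes v: "v \<in> vertices r"
  shows "\<exists>s t. s \<in> vertex_group \<and> t \<in> vertex_group \<and> s \<langle>$\<rangle> v = v \<and> t \<langle>$\<rangle> v = v \<and> s * s = 1 \<and> t * t = 1 \<and>
    (\<forall>A. 1 \<in> A \<and> (\<forall>g\<in>A. g * s \<in> A \<and> g * t \<in> A) \<longrightarrow> {g \<in> vertex_group. g \<langle>$\<rangle> v = v} \<subseteq> A)"
proof -
  obtain \<Phi> where \<Phi>: "\<Phi> \<in> flags r" "v \<in> \<Phi>" 
    using face_in_flag[OF subsetD[OF vertices_subset v]] .
  have i: "1 \<in> {0, 1, 2 :: int}" "2 \<in> {0, 1, 2 :: int}" by simp_all
  obtain f1 where f1: "f1 \<in> polytope_auts r" "vertex_perm r f1 * vertex_perm r f1 = 1"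
    "\<And>\<Psi>. adj 1 \<Phi> \<Psi> \<Longrightarrow> f1 ` \<Phi> = \<Psi>" "f1 ` \<Phi> = \<Phi> \<or> adj 1 \<Phi> (f1 ` \<Phi>)"
    using adjacency_aut[OF \<Phi>(1) i(1)] by blast
  obtain f2 where f2: "f2 \<in> polytope_auts r" "vertex_perm r f2 * vertex_perm r f2 = 1"
    "\<And>\<Psi>. adj 2 \<Phi> \<Psi> \<Longrightarrow> f2 ` \<Phi> = \<Psi>" "f2 ` \<Phi> = \<Phi> \<or> adj 2 \<Phi> (f2 ` \<Phi>)"
    using adjacency_aut[OF \<Phi>(1) i(2)] by blast
  let ?s = "vertex_perm r f1" and ?t = "vertex_perm r f2"
  have fixed: "?s \<langle>$\<rangle> v = v" "?t \<langle>$\<rangle> v = v"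
    using vertex_fixed[OF \<Phi>(1) _ v \<Phi>(2) f1(1) f1(4)] vertex_fixed[OF \<Phi>(1) _ v \<Phi>(2) f2(1) f2(4)] v
    by (simp_all add: apply_vertex_perm[OF f1(1)] apply_vertex_perm[OF f2(1)])
  have gen: "{g \<in> vertex_group. g \<langle>$\<rangle> v = v} \<subseteq> A"
    if A: "1 \<in> A" "\<forall>g\<in>A. g * ?s \<in> A \<and> g * ?t \<in> A" for A
  proof
    fix p assume "p \<in> {g \<in> vertex_group. g \<langle>$\<rangle> v = v}"
    then obtain f where f: "f \<in> polytope_auts r" "p = vertex_perm r f" "f v = v"
      using v by (auto simp: vertex_group_def apply_vertex_perm)
    have fl: "f ` \<Phi> \<in> flags r" using flags_image[OF f(1) \<Phi>(1)] .
    have vf: "v \<in> \<Phi> \<inter> f ` \<Phi>" using \<Phi>(2) f(3) by (metis IntI imageI)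
    \<comment> \<open>The induction carries an automorphism \<open>h\<close> from
      \<open>\<Phi>\<close> to the current flag. Pulling the next step back along \<open>h\<close>
      shows that \<open>h\<close> composed with \<open>f1\<close> or \<open>f2\<close> on the right
      reaches the next flag, which matches the closure of \<open>A\<close>.\<close>
    have "\<exists>h\<in>polytope_auts r. h ` \<Phi> = f ` \<Phi> \<and> vertex_perm r h \<in> A"
      using connected[OF \<Phi>(1) fl]
    proof (induction rule: rtrancl_induct)
      case base
      have "(\<lambda>x\<in>Field r. x) ` \<Phi> = \<Phi>" by (rule image_restrict_id[OF flag_subset_Field[OF \<Phi>(1)]])
      then show ?case using polytope_auts_id vertex_perm_id A(1) by metis
    next
      case (step \<Psi>1 \<Psi>2)
      then have st: "\<Psi>1 \<in> flags r" "\<Psi>2 \<in> flags r" "adjacent_flags \<Psi>1 \<Psi>2" "v \<in> \<Psi>1" "v \<in> \<Psi>2" using vf by auto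
      obtain h where h: "h \<in> polytope_auts r" "h ` \<Phi> = \<Psi>1" "vertex_perm r h \<in> A" using step.IH by blast
      obtain i where i: "i \<in> {0, 1, 2}" "adj i \<Psi>1 \<Psi>2" using adjacent_flags_adj[OF st(1-3)] .
      \<comment> \<open>An exchange in rank 0 would remove the only vertex of
        \<open>\<Psi>1\<close>, which is \<open>v\<close>, yet \<open>v\<close> lies in
        \<open>\<Psi>2\<close>.\<close>
      have "i \<noteq> 0"
      proof
        assume "i = 0"
        then obtain F where "\<Psi>1 - \<Psi>2 = {F}" "F \<in> vertices r" using i(2) by (auto simp: adj_def vertices_def)
        then show False using vertex_in_flag_unique[OF st(1) _ st(4) _ v, of F] st(5) by blast
      qed
      obtain k where k: "k \<in> polytope_auts r" "\<And>F. F \<in> Field r \<Longrightarrow> h (k F) = F"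
        "\<And>F. F \<in> Field r \<Longrightarrow> k (h F) = F" using polytope_aut_inverse[OF h(1)] by blast
      have k1: "k ` \<Psi>1 = \<Phi>"
        using image_inverse_cancel[OF flag_subset_Field[OF \<Phi>(1)], of k h] k(3) h(2) by simp
      have k2: "h ` k ` \<Psi>2 = \<Psi>2"
        using image_inverse_cancel[OF flag_subset_Field[OF st(2)], of h k] k(2) by simp
      have adjk: "adj i \<Phi> (k ` \<Psi>2)" using adj_image[OF k(1) i(2)] k1 by simp
      consider "i = 1" | "i = 2" using i(1) \<open>i \<noteq> 0\<close> by blast
      then obtain g where g: "g \<in> polytope_auts r" "g ` \<Phi> = k ` \<Psi>2" "vertex_perm r h * vertex_perm r g \<in> A"
      proof cases
        case 1
        then have "f1 ` \<Phi> = k ` \<Psi>2" using f1(3) adjk by blast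
        then show ?thesis using that[OF f1(1)] A(2) h(3) by blast
      next
        case 2
        then have "f2 ` \<Phi> = k ` \<Psi>2" using f2(3) adjk by blast
        then show ?thesis using that[OF f2(1)] A(2) h(3) by blast
      qed
      have "compose (Field r) h g ` \<Phi> = h ` g ` \<Phi>"
        by (rule image_compose_restrict[OF flag_subset_Field[OF \<Phi>(1)]])
      then have "compose (Field r) h g ` \<Phi> = \<Psi>2" using g(2) k2 by simp
      then show ?case
        using polytope_auts_compose[OF h(1) g(1)] vertex_perm_compose[OF h(1) g(1)] g(3) by metis
    qed
    then obtain h where "h \<in> polytope_auts r" "h ` \<Phi> = f ` \<Phi>" "vertex_perm r h \<in> A" by blast
    then show "p \<in> A" using vertex_perm_eqI[OF _ f(1) \<Phi>(1)] f(2) by metis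
  qed
  show ?thesis
  proof (rule exI[of _ ?s], rule exI[of _ ?t], intro conjI allI impI)
    show "?s \<in> vertex_group" "?t \<in> vertex_group" using f1(1) f2(1) by (simp_all add: vertex_group_def)
    show "?s \<langle>$\<rangle> v = v" "?t \<langle>$\<rangle> v = v" by (fact fixed)+
    show "?s * ?s = 1" "?t * ?t = 1" by (fact f1(2)) (fact f2(2))
    fix A assume "1 \<in> A \<and> (\<forall>g\<in>A. g * ?s \<in> A \<and> g * ?t \<in> A)"
    then show "{g \<in> vertex_group. g \<langle>$\<rangle> v = v} \<subseteq> A" by (elim conjE) (rule gen)
  qed
qed

end

theorem theorem5p3:
  fixes b :: nat
  assumes "prime b" and "b \<ge> 7"
  shows "\<not> (\<exists>P :: 'a rel. regular_polyhedron P \<and> \<not> flat 3 P \<and> vertex_faithful P \<and>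
              card (vertices P) = 2 * b \<and> vertex_primitive P)"
proof
  assume "\<exists>P :: 'a rel. regular_polyhedron P \<and> \<not> flat 3 P \<and> vertex_faithful P \<and>
    card (vertices P) = 2 * b \<and> vertex_primitive P"
  then obtain r :: "'a rel" where r: "regular_polyhedron r" "card (vertices r) = 2 * b" "vertex_primitive r"
    by (elim exE conjE) (rule that)
  have carr: "carrier (Aut_group r) = polytope_auts r" by (simp add: Aut_group_def)
  let ?V = "vertices r"
  interpret finite_regular_polyhedron r
  proof
    show "abstract_polytope 3 r" using r(1) by (simp add: regular_polytope_def)
    show "\<exists>f\<in>polytope_auts r. f ` \<Phi> = \<Psi>" if "\<Phi> \<in> flags r" "\<Psi> \<in> flags r" for \<Phi> \<Psi>
      using r(1) that carr by (simp add: regular_polytope_def)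
    show "finite ?V" using r(2) assms by (intro card_ge_0_finite) simp
  qed
  have trans_act: "transitive_action (Aut_group r) ?V (vertex_action r)"
    and blocks: "\<And>\<B>. partition_on ?V \<B> \<Longrightarrow> (\<And>f B. f \<in> polytope_auts r \<Longrightarrow> B \<in> \<B> \<Longrightarrow> vertex_action r f ` B \<in> \<B>) \<Longrightarrow>
      \<B> = {?V} \<or> \<B> = (\<lambda>x. {x}) ` ?V"
    using r(3) unfolding vertex_primitive_def primitive_action_def carr by blast+
  have transitive: "\<exists>g\<in>vertex_group. g \<langle>$\<rangle> x = y" if xy: "x \<in> ?V" "y \<in> ?V" for x y
  proof -
    obtain f where "f \<in> polytope_auts r" "vertex_action r f x = y"
      using transitive_action.unique_orbit[OF trans_act xy] carr by blast
    then show ?thesis using xy by (auto simp: vertex_group_def vertex_action_def apply_vertex_perm)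
  qed
  have maps: "g \<langle>$\<rangle> x \<in> ?V" if "g \<in> vertex_group" "x \<in> ?V" for g x
    using that aut_vertex by (auto simp: vertex_group_def apply_vertex_perm)
  interpret dihedral_primitive vertex_group ?V b
  proof
    show "perm_group vertex_group" by (rule perm_group_vertex_group)
    show "g \<langle>$\<rangle> x \<in> ?V" if "g \<in> vertex_group" "x \<in> ?V" for g x using maps that .
    show "g = 1" if "g \<in> vertex_group" "\<And>x. x \<in> ?V \<Longrightarrow> g \<langle>$\<rangle> x = x" for g
      using that by (intro perm_eqI) (auto simp: vertex_group_def apply_vertex_perm)
    show "\<exists>g\<in>vertex_group. g \<langle>$\<rangle> x = y" if "x \<in> ?V" "y \<in> ?V" for x y using transitive that .
    show "prime b" "7 \<le> b" "card ?V = 2 * b" using assms r(2) by auto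
    show "\<exists>s t. s \<in> vertex_group \<and> t \<in> vertex_group \<and> s \<langle>$\<rangle> x = x \<and> t \<langle>$\<rangle> x = x \<and> s * s = 1 \<and> t * t = 1 \<and>
      (\<forall>A. 1 \<in> A \<and> (\<forall>g\<in>A. g * s \<in> A \<and> g * t \<in> A) \<longrightarrow> {g \<in> vertex_group. g \<langle>$\<rangle> x = x} \<subseteq> A)"
      if "x \<in> ?V" for x using stabiliser_generated[OF that] .
    fix \<Delta> v assume \<Delta>: "\<Delta> \<subseteq> ?V" "v \<in> \<Delta>"
      and block: "\<And>g u w. g \<in> vertex_group \<Longrightarrow> u \<in> \<Delta> \<Longrightarrow> g \<langle>$\<rangle> u \<in> \<Delta> \<Longrightarrow> w \<in> \<Delta> \<Longrightarrow> g \<langle>$\<rangle> w \<in> \<Delta>"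
    \<comment> \<open>Primitivity is defined through invariant partitions; the translates of the
      block \<open>\<Delta>\<close> form one.\<close>
    let ?\<B> = "(\<lambda>g. (\<langle>$\<rangle>) g ` \<Delta>) ` vertex_group"
    note GD = perm_groupD[OF perm_group_vertex_group]
    \<comment> \<open>If two translates share a point, \<open>inverse g2 * g1\<close> sends some
      point of \<open>\<Delta>\<close> into \<open>\<Delta>\<close>, and then all of them.\<close>
    have sub: "g1 \<langle>$\<rangle> w \<in> (\<langle>$\<rangle>) g2 ` \<Delta>"
      if g: "g1 \<in> vertex_group" "g2 \<in> vertex_group" and u: "u1 \<in> \<Delta>" "u2 \<in> \<Delta>" "g1 \<langle>$\<rangle> u1 = g2 \<langle>$\<rangle> u2" and w: "w \<in> \<Delta>"
      for g1 g2 u1 u2 w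
    proof -
      have "(inverse g2 * g1) \<langle>$\<rangle> u1 = (inverse g2 * g2) \<langle>$\<rangle> u2" by (simp only: apply_times o_apply u)
      then have "(inverse g2 * g1) \<langle>$\<rangle> u1 \<in> \<Delta>" using u by simp
      then have "(inverse g2 * g1) \<langle>$\<rangle> w \<in> \<Delta>"
        using block[of "inverse g2 * g1" u1 w] GD(4)[OF GD(3)[OF g(2)] g(1)] u w by simp
      then have "g2 \<langle>$\<rangle> ((inverse g2 * g1) \<langle>$\<rangle> w) \<in> (\<langle>$\<rangle>) g2 ` \<Delta>" by (rule imageI)
      then show ?thesis by (simp add: apply_sequence)
    qed
    have "partition_on ?V ?\<B>"
    proof (rule partition_onI)
      show "\<Union>?\<B> = ?V"
      proof
        show "\<Union>?\<B> \<subseteq> ?V" using \<Delta>(1) maps by blast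
        show "?V \<subseteq> \<Union>?\<B>" using transitive[of v] \<Delta> by blast
      qed
      show "disjnt p q" if pq: "p \<in> ?\<B>" "q \<in> ?\<B>" "p \<noteq> q" for p q
      proof (rule ccontr)
        assume "\<not> disjnt p q"
        then obtain x where x: "x \<in> p" "x \<in> q" by (auto simp: disjnt_def)
        obtain g1 where g1: "g1 \<in> vertex_group" "p = (\<langle>$\<rangle>) g1 ` \<Delta>" using pq(1) by blast
        obtain g2 where g2: "g2 \<in> vertex_group" "q = (\<langle>$\<rangle>) g2 ` \<Delta>" using pq(2) by blast
        obtain u1 where u1: "u1 \<in> \<Delta>" "x = g1 \<langle>$\<rangle> u1" using x(1) g1(2) by blast
        obtain u2 where u2: "u2 \<in> \<Delta>" "x = g2 \<langle>$\<rangle> u2" using x(2) g2(2) by blast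
        have eq: "g1 \<langle>$\<rangle> u1 = g2 \<langle>$\<rangle> u2" using u1(2) u2(2) by simp
        have "p \<subseteq> q" unfolding g1(2) using sub[OF g1(1) g2(1) u1(1) u2(1) eq] g2(2) by blast
        moreover have "q \<subseteq> p"
          unfolding g2(2) using sub[OF g2(1) g1(1) u2(1) u1(1) eq[symmetric]] g1(2) by blast
        ultimately show False using pq(3) by blast
      qed
      show "{} \<notin> ?\<B>" using \<Delta>(2) by blast
    qed
    moreover have "vertex_action r f ` B \<in> ?\<B>" if f: "f \<in> polytope_auts r" and B: "B \<in> ?\<B>" for f B
    proof -
      obtain g where g: "g \<in> vertex_group" "B = (\<langle>$\<rangle>) g ` \<Delta>" using B by blast
      have fG: "vertex_perm r f \<in> vertex_group" using f by (simp add: vertex_group_def)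
      have "vertex_action r f (g \<langle>$\<rangle> x) = (vertex_perm r f * g) \<langle>$\<rangle> x" if "x \<in> \<Delta>" for x
        using maps[OF g(1), of x] that \<Delta>(1) by (auto simp: vertex_action_def apply_times apply_vertex_perm[OF f])
      then have "vertex_action r f ` B = (\<langle>$\<rangle>) (vertex_perm r f * g) ` \<Delta>" unfolding g(2) image_image by (intro image_cong) auto
      then show ?thesis using GD(4)[OF fG g(1)] by blast
    qed
    ultimately have "?\<B> = {?V} \<or> ?\<B> = (\<lambda>x. {x}) ` ?V" by (rule blocks)
    \<comment> \<open>\<open>\<Delta>\<close> is its own translate by 1, so the dichotomy for the
      partition applies to it.\<close>
    moreover have "\<Delta> \<in> ?\<B>" using GD(2) by (intro image_eqI[of _ _ 1]) auto
    ultimately show "\<Delta> = ?V \<or> \<Delta> = {v}" using \<Delta>(2) by auto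
  qed
  show False by (rule no_dihedral_primitive)
qed

end
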